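(* Let $\{x^k\}_{k\in\mathbb{N}}$ be the sequence generated by the proximal MM algorithm described in the context. Then: (i) The sequence $\{x^k\}$ has finite length, i.e. $\sum_{k=1}^{\infty}\|x^{k+1}-x^k\|<\infty$. (ii) The sequence $\{x^k\}$ converges to a critical point of $\Theta_{\lambda,\rho}$, say $\overline{x}$ (i.e. $0\in\partial\Theta_{\lambda,\rho}(\overline{x})$), which is also a regular critical point of the zero-norm regularized problem $$\min_{x\in\Omega}\Big\{f(Ax-b)+\frac{\mu}{2}\|x\|^2+\nu\|x\|_0\Big\},\qquad \nu=\lambda/\rho,$$ if $|\overline{x}_{\rm nz}|\ge\frac{2a}{\rho(a+1)}$. (iii) The sequence $\{x^k\}$ converges to $\overline{x}$ in a Q-linear rate.
   Context: Data: $f:\mathbb{R}^n\to\mathbb{R}_+$ is a piecewise linear-quadratic (nonsmooth) convex function, $A\in\mathbb{R}^{n\times p}$, $b\in\mathbb{R}^n$, $\Omega\subseteq\mathbb{R}^p$ is a nonempty polyhedral (convex) set, $\mu>0$, and $F_\mu(x):=f(Ax-b)+\frac{\mu}{2}\|x\|^2$. $\delta_\Omega$ is the indicator function of $\Omega$ ($0$ on $\Omega$, $+\infty$ elsewhere), $e$ is the all-ones vector, $|x|$ the vector of absolute values, and $\|x\|_0$ the number of nonzero entries of $x$. Surrogate: fix $a>1$, let $\phi(t)=\frac{a-1}{a+1}t^2+\frac{2}{a+1}t$, $\psi(t)=\phi(t)$ for $t\in[0,1]$ and $\psi(t)=+\infty$ otherwise, and let $\psi^*$ be its conjugate, i.e.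 $\psi^*(s)=0$ if $s\le\frac{2}{a+1}$, $\psi^*(s)=\frac{((a+1)s-2)^2}{4(a^2-1)}$ if $\frac{2}{a+1}<s\le\frac{2a}{a+1}$, and $\psi^*(s)=s-1$ if $s>\frac{2a}{a+1}$. For $\lambda,\rho>0$, $$\Theta_{\lambda,\rho}(x):=F_\mu(x)+\delta_\Omega(x)+\lambda\|x\|_1-\lambda\rho^{-1}\sum_{i=1}^p\psi^*(\rho|x_i|),\qquad w_\rho(x):=\big((\psi^* )'(\rho|x_1|),\ldots,(\psi^* )'(\rho|x_p|)\big)^{\mathbb{T}}.$$ Algorithm (proximal MM method for minimizing $\Theta_{\lambda,\rho}$; run without stopping): choose $\lambda>0$, $\gamma_{1,0}>0$, $\gamma_{2,0}>0$, $\underline{\gamma_1}>0$, $\underline{\gamma_2}>0$, $\varrho\in(0,1]$, $\rho\ge1$ and $x^0\in\Omega$. For $k=0,1,2,\ldots$: set $w^k=w_\rho(x^k)$; let $x^{k+1}$ be the optimal solution of $$\min_{x\in\Omega}\Big\{F_\mu(x)+\lambda\langle e-w^k,|x|\rangle+\frac{\gamma_{1,k}}{2}\|x-x^k\|^2+\frac{\gamma_{2,k}}{2}\|Ax-Ax^k\|^2\Big\};$$ set $\gamma_{1,k+1}=\max(\underline{\gamma_1},\varrho\gamma_{1,k})$ and $\gamma_{2,k+1}=\max(\underline{\gamma_2},\varrho\gamma_{1,k})$. $\partial$ denotes the limiting subdifferential. A regular critical point of a problem is a point $x$ at which $0$ belongs to the regular (Fréchet) subdifferential of its objective function (with the constraint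 included through $\delta_\Omega$). For a vector $x$, $|x_{\rm nz}|$ denotes the smallest absolute value among the nonzero entries of $x$. *)

theory Defs
  imports "HOL-Analysis.Analysis"
begin

text \<open>
  Rockafellar and Wets, Definition 10.20, for functions with full domain.
\<close>
definition piecewise_linear_quadratic :: "(real ^ 'n \<Rightarrow> real) \<Rightarrow> bool" where
  "piecewise_linear_quadratic f \<longleftrightarrow>
     (\<exists>\<P>. finite \<P> \<and> \<Union>\<P> = UNIV \<and>
        (\<forall>C\<in>\<P>. polyhedron C \<and>
           (\<exists>Q c \<alpha>. transpose Q = Q \<and>
              (\<forall>y\<in>C. f y = (1/2) * (y \<bullet> (Q *v y)) + c \<bullet> y + \<alpha>))))"

definition delta :: "'a set \<Rightarrow> 'a \<Rightarrow> ereal" where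
  "delta \<Omega> x = (if x \<in> \<Omega> then 0 else \<infinity>)"

definition norm_1 :: "real ^ 'p \<Rightarrow> real" where
  "norm_1 x = (\<Sum>i\<in>UNIV. \<bar>x $ i\<bar>)"

definition norm_0 :: "real ^ 'p \<Rightarrow> nat" where
  "norm_0 x = card {i. x $ i \<noteq> 0}"

text \<open>
  For \<open>x = 0\<close> the infimum over the empty index set is \<open>\<infinity>\<close>.
\<close>
definition min_abs_nz :: "real ^ 'p \<Rightarrow> ereal" where
  "min_abs_nz x = (INF i\<in>{i. x $ i \<noteq> 0}. ereal \<bar>x $ i\<bar>)"

text \<open>
  Subdifferentials of extended-real-valued functions (Rockafellar and Wets, Definition 8.3); both
  are empty at points where the function value is not finite.
\<close>
definition regular_subdifferential :: "('a::real_inner \<Rightarrow> ereal) \<Rightarrow> 'a \<Rightarrow> 'a set" where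
  "regular_subdifferential h x =
     {v. \<bar>h x\<bar> \<noteq> \<infinity> \<and>
         0 \<le> Liminf (at x) (\<lambda>y. (h y - h x - ereal (v \<bullet> (y - x))) / ereal (norm (y - x)))}"

definition limiting_subdifferential :: "('a::real_inner \<Rightarrow> ereal) \<Rightarrow> 'a \<Rightarrow> 'a set" where
  "limiting_subdifferential h x =
     {v. \<bar>h x\<bar> \<noteq> \<infinity> \<and>
         (\<exists>y u. y \<longlonglongrightarrow> x \<and> (\<lambda>k. h (y k)) \<longlonglongrightarrow> h x \<and> u \<longlonglongrightarrow> v \<and>
                (\<forall>k::nat. u k \<in> regular_subdifferential h (y k)))}"

definition critical_point :: "('a::real_inner \<Rightarrow> ereal) \<Rightarrow> 'a \<Rightarrow> bool" where
  "critical_point h x \<longleftrightarrow> 0 \<in> limiting_subdifferential h x"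

definition regular_critical_point :: "('a::real_inner \<Rightarrow> ereal) \<Rightarrow> 'a \<Rightarrow> bool" where
  "regular_critical_point h x \<longleftrightarrow> 0 \<in> regular_subdifferential h x"

definition phi :: "real \<Rightarrow> real \<Rightarrow> real" where
  "phi a t = (a - 1) / (a + 1) * t\<^sup>2 + 2 / (a + 1) * t"

definition psi :: "real \<Rightarrow> real \<Rightarrow> ereal" where
  "psi a t = (if t \<in> {0..1} then ereal (phi a t) else \<infinity>)"

definition conjugate :: "(real \<Rightarrow> ereal) \<Rightarrow> real \<Rightarrow> ereal" where
  "conjugate h s = (SUP t. ereal (s * t) - h t)"

definition psi_star :: "real \<Rightarrow> real \<Rightarrow> real" where
  "psi_star a s =
     (if s \<le> 2 / (a + 1) then 0
      else if s \<le> 2 * a / (a + 1) then ((a + 1) * s - 2)\<^sup>2 / (4 * (a\<^sup>2 - 1))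
      else s - 1)"

lemma conjugate_psi:
  assumes "a > 1"
  shows "conjugate (psi a) s = ereal (psi_star a s)"
proof -
  define c d where "c = (a - 1) / (a + 1)" and "d = 2 / (a + 1)"
  have c: "c > 0" using assms by (simp add: c_def)
  have cd: "c + d = 1" "2 * c + d = 2 * a / (a + 1)"
    using assms by (simp_all add: c_def d_def add_divide_distrib[symmetric])
  have phi: "phi a t = c * t\<^sup>2 + d * t" for t by (simp add: phi_def c_def d_def)
  have mid: "((a + 1) * s - 2)\<^sup>2 / (4 * (a\<^sup>2 - 1)) = (s - d)\<^sup>2 / (4 * c)"
  proof -
    have "(a + 1) * s - 2 = (a + 1) * (s - d)"
      using assms by (simp add: d_def field_simps)
    moreover have "4 * (a\<^sup>2 - 1) = (a + 1)\<^sup>2 * (4 * c)"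
      using assms by (simp add: c_def power2_eq_square field_simps)
    ultimately show ?thesis using assms by (simp add: power_mult_distrib)
  qed
  have star: "psi_star a s =
    (if s \<le> d then 0 else if s \<le> 2 * c + d then (s - d)\<^sup>2 / (4 * c) else s - 1)"
    unfolding psi_star_def mid cd(2) by (simp add: d_def)
  define t0 where "t0 = (if s \<le> d then 0 else if s \<le> 2 * c + d then (s - d) / (2 * c) else 1)"
  have t0: "t0 \<in> {0..1}" using c cd(1) by (auto simp: t0_def field_simps)
  have att: "s * t0 - phi a t0 = psi_star a s"
  proof -
    have "s * ((s - d) / (2 * c)) - phi a ((s - d) / (2 * c)) = (s - d)\<^sup>2 / (4 * c)"
      using c by (simp add: phi power2_eq_square field_simps)
    then show ?thesis using cd(1) by (simp add: t0_def star phi)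
  qed
  have ub: "s * t - phi a t \<le> psi_star a s" if "t \<in> {0..1}" for t
  proof -
    consider "s \<le> d" | "s > d" "s \<le> 2 * c + d" | "s > d" "s > 2 * c + d" by linarith
    then show ?thesis
    proof cases
      case 1
      have "(s - d) * t \<le> 0" using 1 that by (simp add: mult_nonpos_nonneg)
      moreover have "0 \<le> c * t\<^sup>2" using c by simp
      ultimately show ?thesis using 1 by (simp add: star phi algebra_simps)
    next
      case 2
      have "0 \<le> c * (t - (s - d) / (2 * c))\<^sup>2" using c by simp
      also have "\<dots> = (s - d)\<^sup>2 / (4 * c) - (s * t - phi a t)"
        using c by (simp add: phi power2_eq_square field_simps)
      finally show ?thesis using 2 by (simp add: star)
    next
      case 3
      have "0 \<le> (1 - t) * (s - d - c * (1 + t))"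
      proof (rule mult_nonneg_nonneg)
        have "c * (1 + t) \<le> c * 2" using c that by simp
        then show "0 \<le> s - d - c * (1 + t)" using 3 by linarith
      qed (use that in simp)
      also have "\<dots> = (s - (c + d)) - (s * t - phi a t)"
        by (simp add: phi power2_eq_square algebra_simps)
      finally show ?thesis using 3 c by (simp add: star cd(1))
    qed
  qed
  show ?thesis unfolding conjugate_def
  proof (rule antisym)
    show "(SUP t. ereal (s * t) - psi a t) \<le> ereal (psi_star a s)"
      by (rule SUP_least) (use ub in \<open>auto simp: psi_def\<close>)
    have "ereal (psi_star a s) = ereal (s * t0) - psi a t0"
      using t0 att by (simp add: psi_def)
    also have "\<dots> \<le> (SUP t. ereal (s * t) - psi a t)" by (rule SUP_upper) simp
    finally show "ereal (psi_star a s) \<le> (SUP t. ereal (s * t) - psi a t)" .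
  qed
qed

definition F_reg ::
  "(real ^ 'n \<Rightarrow> real) \<Rightarrow> real ^ 'p ^ 'n \<Rightarrow> real ^ 'n \<Rightarrow> real \<Rightarrow> real ^ 'p \<Rightarrow> real" where
  "F_reg f A b \<mu> x = f (A *v x - b) + \<mu> / 2 * (norm x)\<^sup>2"

definition Theta ::
  "(real ^ 'n \<Rightarrow> real) \<Rightarrow> real ^ 'p ^ 'n \<Rightarrow> real ^ 'n \<Rightarrow> (real ^ 'p) set \<Rightarrow> real \<Rightarrow> real \<Rightarrow> real \<Rightarrow> real
    \<Rightarrow> real ^ 'p \<Rightarrow> ereal" where
  "Theta f A b \<Omega> \<mu> a lam \<rho> x =
     ereal (F_reg f A b \<mu> x) + delta \<Omega> x + ereal (lam * norm_1 x)
     - ereal (lam * inverse \<rho> * (\<Sum>i\<in>UNIV. psi_star a (\<rho> * \<bar>x $ i\<bar>)))"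

definition zero_norm_objective ::
  "(real ^ 'n \<Rightarrow> real) \<Rightarrow> real ^ 'p ^ 'n \<Rightarrow> real ^ 'n \<Rightarrow> (real ^ 'p) set \<Rightarrow> real \<Rightarrow> real
    \<Rightarrow> real ^ 'p \<Rightarrow> ereal" where
  "zero_norm_objective f A b \<Omega> \<mu> \<nu> x =
     ereal (f (A *v x - b) + \<mu> / 2 * (norm x)\<^sup>2 + \<nu> * real (norm_0 x)) + delta \<Omega> x"

definition w_rho :: "real \<Rightarrow> real \<Rightarrow> real ^ 'p \<Rightarrow> real ^ 'p" where
  "w_rho a \<rho> x = (\<chi> i. deriv (psi_star a) (\<rho> * \<bar>x $ i\<bar>))"

text \<open>
  In the instances for \<open>real ^ 'p\<close>, \<open>1\<close> is the all-ones vector and \<open>\<bar>x\<bar>\<close> the vector of absolute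
  values.
\<close>
definition MM_model ::
  "(real ^ 'n \<Rightarrow> real) \<Rightarrow> real ^ 'p ^ 'n \<Rightarrow> real ^ 'n \<Rightarrow> real \<Rightarrow> real \<Rightarrow> real \<Rightarrow> real \<Rightarrow> real \<Rightarrow> real
    \<Rightarrow> real ^ 'p \<Rightarrow> real ^ 'p \<Rightarrow> real" where
  "MM_model f A b \<mu> a lam \<rho> \<gamma>\<^sub>1 \<gamma>\<^sub>2 z x =
     F_reg f A b \<mu> x + lam * ((1 - w_rho a \<rho> z) \<bullet> \<bar>x\<bar>)
     + \<gamma>\<^sub>1 / 2 * (norm (x - z))\<^sup>2 + \<gamma>\<^sub>2 / 2 * (norm (A *v x - A *v z))\<^sup>2"

text \<open>
  The proximal parameters are sequences determined by \<open>\<gamma>\<^sub>1 0\<close>, \<open>\<gamma>\<^sub>2 0\<close> and the update rule; the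
  recursion for \<open>\<gamma>\<^sub>2\<close> does refer to \<open>\<gamma>\<^sub>1\<close>.
\<close>
definition proximal_MM_sequence ::
  "(real ^ 'n \<Rightarrow> real) \<Rightarrow> real ^ 'p ^ 'n \<Rightarrow> real ^ 'n \<Rightarrow> (real ^ 'p) set \<Rightarrow> real \<Rightarrow> real \<Rightarrow> real \<Rightarrow> real
    \<Rightarrow> real \<Rightarrow> real \<Rightarrow> real \<Rightarrow> (nat \<Rightarrow> real) \<Rightarrow> (nat \<Rightarrow> real) \<Rightarrow> (nat \<Rightarrow> real ^ 'p) \<Rightarrow> bool" where
  "proximal_MM_sequence f A b \<Omega> \<mu> a lam \<rho> \<gamma>1_low \<gamma>2_low varrho \<gamma>\<^sub>1 \<gamma>\<^sub>2 x \<longleftrightarrow>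
     x 0 \<in> \<Omega> \<and>
     (\<forall>k. is_arg_min (MM_model f A b \<mu> a lam \<rho> (\<gamma>\<^sub>1 k) (\<gamma>\<^sub>2 k) (x k)) (\<lambda>z. z \<in> \<Omega>) (x (Suc k)) \<and>
          \<gamma>\<^sub>1 (Suc k) = max \<gamma>1_low (varrho * \<gamma>\<^sub>1 k) \<and>
          \<gamma>\<^sub>2 (Suc k) = max \<gamma>2_low (varrho * \<gamma>\<^sub>1 k))"

text \<open>
  Product form of the quotient condition, so that sequences reaching the limit are included.
\<close>
definition Q_linearly_converges :: "(nat \<Rightarrow> 'a::real_normed_vector) \<Rightarrow> 'a \<Rightarrow> bool" where
  "Q_linearly_converges x l \<longleftrightarrow>
     x \<longlonglongrightarrow> l \<and>
     (\<exists>c. 0 < c \<and> c < 1 \<and> (\<forall>\<^sub>F k in sequentially. norm (x (Suc k) - l) \<le> c * norm (x k - l)))"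

end

theory Submission
  imports Defs
begin

text \<open>
  The proximal parameters become constant after finitely many steps, so the tail of the iteration
  has fixed \<open>\<gamma>\<^sub>1\<close> and \<open>\<gamma>\<^sub>2\<close>. Write \<open>\<theta>\<close> for the surrogate on \<open>\<Omega>\<close>. The weighted \<open>\<ell>\<^sub>1\<close> term of the model
  majorizes, up to a constant, the regularizer of \<open>\<theta>\<close>, with an error of second order at the centre. Minimality
  of \<open>x\<^sub>k\<^sub>+\<^sub>1\<close> therefore gives a decrease of \<open>\<theta>\<close> by a multiple of \<open>\<parallel>x\<^sub>k\<^sub>+\<^sub>1 - x\<^sub>k\<parallel>\<^sup>2\<close>, and near stationarity
  of \<open>\<theta>\<close> at \<open>x\<^sub>k\<^sub>+\<^sub>1\<close> with an error proportional to \<open>\<parallel>x\<^sub>k\<^sub>+\<^sub>1 - x\<^sub>k\<parallel>\<close> (\<open>theta_slope\<close>).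

  Finite length. The function \<open>\<theta>\<close> is quadratic on each of finitely many polyhedral cells. A point of
  a cell with active constraints \<open>I\<close> can be moved in both senses along the directions orthogonal to
  \<open>I\<close>, so near stationarity bounds the gradient of the quadratic along these directions. A quadratic
  on an affine set has at most one critical value and deviates from it by at most a multiple of the
  squared gradient. There are only finitely many pairs of a cell and an active set, hence finitely many
  critical values; since the steps tend to zero, eventually the only relevant one is the limit of the
  values of \<open>\<theta>\<close>. This yields geometric decay of the steps
  (\<open>piecewise_quadratic_descent_steps_geometric\<close>), and with it convergence to some \<open>p\<close>.

  Criticality. The limit \<open>p\<close> minimizes the model centred at \<open>p\<close>. Its increments from \<open>p\<close> agree with those of
  \<open>\<theta>\<close> up to second order, so \<open>0\<close> is a regular, hence a limiting, subgradient of \<open>\<theta>\<close>. If the nonzero entries of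
  \<open>p\<close> are large, the weights at \<open>p\<close> are \<open>1\<close> on its support and \<open>0\<close> elsewhere, and the linearized
  penalty is dominated near \<open>p\<close> by the jump of the zero norm.

  Q-linear rate. Geometric decay of the values and the steps alone only bounds the error by a
  geometric sequence, while the claim concerns the ratio of successive Euclidean errors. Put
  \<open>d\<^sub>k = x\<^sub>k - p\<close>. Near \<open>p\<close> the data are locally homogeneous: the change of the weights
  is one-sidedly linear, and the model at \<open>p\<close> has no linear term along the segment from \<open>p\<close> to \<open>x\<^sub>k\<close>,
  because every face that is visited infinitely often contains \<open>p\<close> and \<open>p\<close> is stationary along it
  (\<open>piecewise_quadratic_radially_homogeneous\<close>). So the iteration is eventually a nonlinear power method
  for a pair of functions homogeneous of degree two along the iterates. Its Rayleigh quotient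
  increases to a limit, which is also the limit of the ratios \<open>\<parallel>d\<^sub>k\<^sub>+\<^sub>1\<parallel> / \<parallel>d\<^sub>k\<parallel>\<close> and, by the geometric
  bound, is less than \<open>1\<close> (\<open>nonlinear_power_method_Q_linear\<close>).
\<close>

section \<open>Piecewise quadratic functions on polyhedral sets\<close>

definition halfspaces :: "('a::euclidean_space \<times> real) set \<Rightarrow> 'a set" where
  "halfspaces H = {x. \<forall>(a, \<beta>)\<in>H. a \<bullet> x \<le> \<beta>}"

definition active :: "('a::euclidean_space \<times> real) set \<Rightarrow> 'a \<Rightarrow> ('a \<times> real) set" where
  "active H x = {(a, \<beta>)\<in>H. a \<bullet> x = \<beta>}"

definition face_directions :: "('a::euclidean_space \<times> real) set \<Rightarrow> 'a set" where
  "face_directions I = {u. \<forall>(a, \<beta>)\<in>I. a \<bullet> u = 0}"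

definition self_adjoint :: "('a::euclidean_space \<Rightarrow> 'a) \<Rightarrow> bool" where
  "self_adjoint Q \<longleftrightarrow> linear Q \<and> (\<forall>x y. x \<bullet> Q y = Q x \<bullet> y)"

definition quadratic_on :: "'a::euclidean_space set \<Rightarrow> ('a \<Rightarrow> real) \<Rightarrow> bool" where
  "quadratic_on C f \<longleftrightarrow>
     (\<exists>Q c \<alpha>. self_adjoint Q \<and> (\<forall>x\<in>C. f x = 1/2 * (x \<bullet> Q x) + c \<bullet> x + \<alpha>))"

definition piecewise_quadratic_on :: "'a::euclidean_space set \<Rightarrow> ('a \<Rightarrow> real) \<Rightarrow> bool" where
  "piecewise_quadratic_on S f \<longleftrightarrow>
     (\<exists>\<H>. finite \<H> \<and> S = (\<Union>H\<in>\<H>. halfspaces H)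
        \<and> (\<forall>H\<in>\<H>. finite H \<and> quadratic_on (halfspaces H) f))"

lemma halfspaces_Un: "halfspaces (H \<union> K) = halfspaces H \<inter> halfspaces K"
  by (auto simp: halfspaces_def)

lemma convex_halfspaces: "convex (halfspaces H)"
proof -
  have "halfspaces H = (\<Inter>h\<in>H. {x. fst h \<bullet> x \<le> snd h})"
    by (auto simp: halfspaces_def split_beta)
  then show ?thesis by (simp add: convex_INT convex_halfspace_le)
qed

lemma closed_halfspaces: "closed (halfspaces H)"
proof -
  have "halfspaces H = (\<Inter>h\<in>H. {x. fst h \<bullet> x \<le> snd h})"
    by (auto simp: halfspaces_def split_beta)
  then show ?thesis by (simp add: closed_INT closed_halfspace_le)
qed

lemma polyhedron_halfspaces:
  assumes "polyhedron S"
  obtains H where "finite H" "S = halfspaces H"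
proof -
  obtain F where F: "finite F" "S = \<Inter>F" "\<forall>h\<in>F. \<exists>a b. a \<noteq> 0 \<and> h = {x. a \<bullet> x \<le> b}"
    using assms unfolding polyhedron_def by (elim exE conjE)
  from F(3) have "\<forall>h\<in>F. \<exists>p. h = {x. fst p \<bullet> x \<le> snd p}" by fastforce
  from bchoice[OF this] obtain p where p: "\<forall>h\<in>F. h = {x. fst (p h) \<bullet> x \<le> snd (p h)}"
    by (elim exE)
  have "x \<in> S \<longleftrightarrow> x \<in> halfspaces (p ` F)" for x
  proof -
    have "x \<in> h \<longleftrightarrow> fst (p h) \<bullet> x \<le> snd (p h)" if "h \<in> F" for h
      using p that by blast
    then show ?thesis by (simp add: halfspaces_def F(2) split_beta)
  qed
  then have "S = halfspaces (p ` F)" by blast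
  with F(1) show thesis by (intro that[of "p ` F"]) simp_all
qed

lemma quadratic_on_subset: "quadratic_on C f \<Longrightarrow> D \<subseteq> C \<Longrightarrow> quadratic_on D f"
  unfolding quadratic_on_def by blast

lemma quadratic_on_cong: "(\<And>x. x \<in> C \<Longrightarrow> f x = g x) \<Longrightarrow> quadratic_on C f \<longleftrightarrow> quadratic_on C g"
  unfolding quadratic_on_def by simp

lemma quadratic_on_add:
  assumes "quadratic_on C f" "quadratic_on C g"
  shows "quadratic_on C (\<lambda>x. f x + g x)"
proof -
  obtain Q c \<alpha> R d \<beta> where
    f: "self_adjoint Q" "\<forall>x\<in>C. f x = 1/2 * (x \<bullet> Q x) + c \<bullet> x + \<alpha>" and
    g: "self_adjoint R" "\<forall>x\<in>C. g x = 1/2 * (x \<bullet> R x) + d \<bullet> x + \<beta>"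
    using assms unfolding quadratic_on_def by blast
  have "self_adjoint (\<lambda>x. Q x + R x)"
    using f(1) g(1) by (auto simp: self_adjoint_def inner_simps intro: linear_compose_add)
  moreover have "\<forall>x\<in>C. f x + g x = 1/2 * (x \<bullet> (Q x + R x)) + (c + d) \<bullet> x + (\<alpha> + \<beta>)"
    using f(2) g(2) by (simp add: inner_simps algebra_simps)
  ultimately show ?thesis unfolding quadratic_on_def by blast
qed

lemma quadratic_on_scale:
  assumes "quadratic_on C f"
  shows "quadratic_on C (\<lambda>x. s * f x)"
proof -
  obtain Q c \<alpha> where
    f: "self_adjoint Q" "\<forall>x\<in>C. f x = 1/2 * (x \<bullet> Q x) + c \<bullet> x + \<alpha>"
    using assms unfolding quadratic_on_def by blast
  have "self_adjoint (\<lambda>x. s *\<^sub>R Q x)"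
    using f(1) by (auto simp: self_adjoint_def intro: linear_compose_scale_right)
  moreover have "\<forall>x\<in>C. s * f x = 1/2 * (x \<bullet> (s *\<^sub>R Q x)) + (s *\<^sub>R c) \<bullet> x + s * \<alpha>"
    using f(2) by (simp add: algebra_simps)
  ultimately show ?thesis unfolding quadratic_on_def by blast
qed

lemma quadratic_expansion:
  assumes "self_adjoint Q"
  shows "1/2 * ((x + u) \<bullet> Q (x + u)) + c \<bullet> (x + u) + \<alpha>
    = (1/2 * (x \<bullet> Q x) + c \<bullet> x + \<alpha>) + (Q x + c) \<bullet> u + 1/2 * (u \<bullet> Q u)"
proof -
  have Q: "linear Q" "x \<bullet> Q u = Q x \<bullet> u" using assms by (auto simp: self_adjoint_def)
  have "u \<bullet> Q x = Q x \<bullet> u" by (simp add: inner_commute)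
  with Q(2) show ?thesis by (simp add: linear_add[OF Q(1)] inner_add_left inner_add_right)
qed

lemma quadratic_on_affine_compose:
  fixes L :: "'a::euclidean_space \<Rightarrow> 'b::euclidean_space"
  assumes "quadratic_on C f" and L: "linear L"
  shows "quadratic_on {x. L x + v \<in> C} (\<lambda>x. f (L x + v))"
proof -
  obtain Q c \<alpha> where
    f: "self_adjoint Q" "\<forall>x\<in>C. f x = 1/2 * (x \<bullet> Q x) + c \<bullet> x + \<alpha>"
    using assms unfolding quadratic_on_def by blast
  have Q: "linear Q" "\<And>x y. x \<bullet> Q y = Q x \<bullet> y" using f(1) by (auto simp: self_adjoint_def)
  have adj: "x \<bullet> adjoint L y = L x \<bullet> y" "adjoint L y \<bullet> x = y \<bullet> L x" for x y
    using adjoint_works[OF L] by (auto simp: inner_commute)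
  have "linear (\<lambda>x. adjoint L (Q (L x)))"
    using linear_compose[OF linear_compose[OF L Q(1)] adjoint_linear[OF L]] by (simp add: o_def)
  then have "self_adjoint (\<lambda>x. adjoint L (Q (L x)))"
    by (simp only: self_adjoint_def adj Q(2)) simp
  moreover have "f (L x + v) = 1/2 * (x \<bullet> adjoint L (Q (L x))) + adjoint L (Q v + c) \<bullet> x
      + (1/2 * (v \<bullet> Q v) + c \<bullet> v + \<alpha>)" if "L x + v \<in> C" for x
    using f(2) that quadratic_expansion[OF f(1), of v "L x" c \<alpha>]
    by (simp add: adj add.commute)
  ultimately show ?thesis unfolding quadratic_on_def by blast
qed

lemma quadratic_on_inner: "quadratic_on C (\<lambda>x. c \<bullet> x + \<alpha>)"
proof -
  have "self_adjoint (\<lambda>x::'a. 0)"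
    by (simp add: self_adjoint_def linear_zero)
  then show ?thesis
    unfolding quadratic_on_def by (intro exI[of _ "\<lambda>x. 0"] exI[of _ c] exI[of _ \<alpha>]) auto
qed

lemma quadratic_on_norm_power2: "quadratic_on C (\<lambda>x. (norm x)\<^sup>2)"
proof -
  have "self_adjoint (\<lambda>x::'a. 2 *\<^sub>R x)"
    by (simp add: self_adjoint_def linear_scaleR)
  moreover have "\<forall>x\<in>C. (norm x)\<^sup>2 = 1/2 * (x \<bullet> (2 *\<^sub>R x)) + 0 \<bullet> x + 0"
    by (simp add: power2_norm_eq_inner)
  ultimately show ?thesis unfolding quadratic_on_def by blast
qed

lemma piecewise_quadratic_onI:
  assumes "finite I" "\<And>x. x \<in> S \<longleftrightarrow> (\<exists>i\<in>I. x \<in> halfspaces (H i))" "\<And>i. i \<in> I \<Longrightarrow> finite (H i)"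
    and "\<And>i. i \<in> I \<Longrightarrow> quadratic_on (halfspaces (H i)) f"
  shows "piecewise_quadratic_on S f"
proof -
  have "S = (\<Union>K\<in>H ` I. halfspaces K)" using assms(2) by blast
  with assms(1,3,4) show ?thesis
    unfolding piecewise_quadratic_on_def by (intro exI[of _ "H ` I"] conjI) simp_all
qed

lemma piecewise_quadratic_onE:
  assumes "piecewise_quadratic_on S f"
  obtains \<H> where "finite \<H>" "\<forall>x. x \<in> S \<longleftrightarrow> (\<exists>H\<in>\<H>. x \<in> halfspaces H)"
    "\<forall>H\<in>\<H>. finite H" "\<forall>H\<in>\<H>. quadratic_on (halfspaces H) f"
proof -
  obtain \<H> where "finite \<H>" "S = (\<Union>H\<in>\<H>. halfspaces H)"
    "\<forall>H\<in>\<H>. finite H \<and> quadratic_on (halfspaces H) f"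
    using assms unfolding piecewise_quadratic_on_def by blast
  then show thesis by (intro that[of \<H>]) auto
qed

lemma piecewise_quadratic_on_global:
  assumes "quadratic_on UNIV f" shows "piecewise_quadratic_on UNIV f"
  by (rule piecewise_quadratic_onI[of "{()}" _ "\<lambda>_. {}"]) (use assms in \<open>auto simp: halfspaces_def\<close>)

lemma piecewise_quadratic_on_scale:
  "piecewise_quadratic_on S f \<Longrightarrow> piecewise_quadratic_on S (\<lambda>x. s * f x)"
  unfolding piecewise_quadratic_on_def by (elim exE, rule exI) (auto intro: quadratic_on_scale)

text \<open>Two subdivisions are merged by intersecting their cells.\<close>

lemma piecewise_quadratic_on_add_Int:
  assumes "piecewise_quadratic_on S f" "piecewise_quadratic_on T g"
  shows "piecewise_quadratic_on (S \<inter> T) (\<lambda>x. f x + g x)"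
proof -
  obtain \<H> where f': "finite \<H>" "\<forall>x. x \<in> S \<longleftrightarrow> (\<exists>H\<in>\<H>. x \<in> halfspaces H)"
    "\<forall>H\<in>\<H>. finite H" "\<forall>H\<in>\<H>. quadratic_on (halfspaces H) f"
    by (rule piecewise_quadratic_onE[OF assms(1)])
  note f = f'[rule_format]
  obtain \<K> where g': "finite \<K>" "\<forall>x. x \<in> T \<longleftrightarrow> (\<exists>H\<in>\<K>. x \<in> halfspaces H)"
    "\<forall>H\<in>\<K>. finite H" "\<forall>H\<in>\<K>. quadratic_on (halfspaces H) g"
    by (rule piecewise_quadratic_onE[OF assms(2)])
  note g = g'[rule_format]
  show ?thesis
  proof (rule piecewise_quadratic_onI[of "\<H> \<times> \<K>" _ "\<lambda>(H, K). H \<union> K"])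
    show "x \<in> S \<inter> T \<longleftrightarrow> (\<exists>i\<in>\<H> \<times> \<K>. x \<in> halfspaces (case i of (H, K) \<Rightarrow> H \<union> K))" for x
      using f(2)[of x] g(2)[of x] by (auto simp: halfspaces_Un)
    fix i assume "i \<in> \<H> \<times> \<K>"
    then obtain H K where i: "i = (H, K)" "H \<in> \<H>" "K \<in> \<K>" by blast
    have "quadratic_on (halfspaces (H \<union> K)) (\<lambda>x. f x + g x)"
      unfolding halfspaces_Un
      by (intro quadratic_on_add quadratic_on_subset[OF f(4)[OF i(2)]]
          quadratic_on_subset[OF g(4)[OF i(3)]]) auto
    then show "quadratic_on (halfspaces (case i of (H, K) \<Rightarrow> H \<union> K)) (\<lambda>x. f x + g x)"
      by (simp add: i(1))
    show "finite (case i of (H, K) \<Rightarrow> H \<union> K)"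
      by (simp add: i(1) f(3)[OF i(2)] g(3)[OF i(3)])
  qed (rule finite_cartesian_product[OF f(1) g(1)])
qed

lemma piecewise_quadratic_on_add:
  "piecewise_quadratic_on S f \<Longrightarrow> piecewise_quadratic_on S g
    \<Longrightarrow> piecewise_quadratic_on S (\<lambda>x. f x + g x)"
  using piecewise_quadratic_on_add_Int[of S f S g] by simp

lemma piecewise_quadratic_on_sum:
  assumes "finite I" "\<And>i. i \<in> I \<Longrightarrow> piecewise_quadratic_on UNIV (f i)"
  shows "piecewise_quadratic_on UNIV (\<lambda>x. \<Sum>i\<in>I. f i x)"
  using assms
proof (induction I rule: finite_induct)
  case empty
  show ?case
    using piecewise_quadratic_on_global[OF quadratic_on_inner[of UNIV 0 0]] by simp
next
  case (insert i I)
  then have "piecewise_quadratic_on UNIV (\<lambda>x. f i x + (\<Sum>j\<in>I. f j x))"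
    by (intro piecewise_quadratic_on_add) simp_all
  with insert.hyps show ?case by simp
qed

lemma piecewise_quadratic_on_polyhedron:
  assumes "piecewise_quadratic_on UNIV f" "polyhedron S"
  shows "piecewise_quadratic_on S f"
proof -
  obtain H where H: "finite H" "S = halfspaces H" using assms(2) by (rule polyhedron_halfspaces)
  have "piecewise_quadratic_on S (\<lambda>x. 0)"
    using quadratic_on_inner[of S 0 0] H(1)
    by (intro piecewise_quadratic_onI[of "{H}" _ "\<lambda>H. H"]) (simp_all add: H(2))
  from piecewise_quadratic_on_add_Int[OF assms(1) this] show ?thesis by simp
qed

lemma piecewise_quadratic_on_affine_compose:
  fixes L :: "'a::euclidean_space \<Rightarrow> 'b::euclidean_space"
  assumes "piecewise_quadratic_on UNIV f" and L: "linear L"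
  shows "piecewise_quadratic_on UNIV (\<lambda>x. f (L x + v))"
proof -
  obtain \<H> where f': "finite \<H>" "\<forall>x. x \<in> UNIV \<longleftrightarrow> (\<exists>H\<in>\<H>. x \<in> halfspaces H)"
    "\<forall>H\<in>\<H>. finite H" "\<forall>H\<in>\<H>. quadratic_on (halfspaces H) f"
    by (rule piecewise_quadratic_onE[OF assms(1)])
  note f = f'[rule_format]
  define p where "p = (\<lambda>(a, \<beta>). (adjoint L a, \<beta> - a \<bullet> v))"
  have adj: "adjoint L a \<bullet> x = a \<bullet> L x" for a x
    using adjoint_works[OF L, of x a] inner_commute[of "adjoint L a" x] inner_commute[of a "L x"]
    by linarith
  have hp: "halfspaces (p ` H) = {x. L x + v \<in> halfspaces H}" for H
    by (simp add: halfspaces_def p_def inner_add_right le_diff_eq split_beta adj)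
  show ?thesis
  proof (rule piecewise_quadratic_onI[of \<H> _ "\<lambda>H. p ` H"])
    show "x \<in> UNIV \<longleftrightarrow> (\<exists>H\<in>\<H>. x \<in> halfspaces (p ` H))" for x
      using f(2)[of "L x + v"] unfolding hp by simp
    show "finite (p ` H)" if "H \<in> \<H>" for H by (rule finite_imageI[OF f(3)[OF that]])
    show "quadratic_on (halfspaces (p ` H)) (\<lambda>x. f (L x + v))" if "H \<in> \<H>" for H
      unfolding hp by (rule quadratic_on_affine_compose[OF f(4)[OF that] L])
  qed (rule f(1))
qed

lemma piecewise_linear_quadratic_imp_piecewise_quadratic_on:
  fixes f :: "real ^ 'n \<Rightarrow> real"
  assumes "piecewise_linear_quadratic f"
  shows "piecewise_quadratic_on UNIV f"
proof -
  obtain \<P> where P': "finite \<P>" "\<Union>\<P> = UNIV"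
    "\<forall>C\<in>\<P>. polyhedron C \<and>
       (\<exists>Q c \<alpha>. transpose Q = Q \<and> (\<forall>y\<in>C. f y = (1/2) * (y \<bullet> (Q *v y)) + c \<bullet> y + \<alpha>))"
    using assms unfolding piecewise_linear_quadratic_def by (elim exE conjE)
  note P = P'(1,2) P'(3)[THEN bspec, THEN conjunct1] P'(3)[THEN bspec, THEN conjunct2]
  have "\<forall>C\<in>\<P>. \<exists>H. finite H \<and> halfspaces H = C"
  proof
    fix C assume "C \<in> \<P>"
    from P(3)[OF this] obtain H where "finite H" "C = halfspaces H"
      by (rule polyhedron_halfspaces)
    then show "\<exists>H. finite H \<and> halfspaces H = C" by (intro exI[of _ H]) simp
  qed
  from bchoice[OF this] obtain h where h': "\<forall>C\<in>\<P>. finite (h C) \<and> halfspaces (h C) = C"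
    by (elim exE)
  note h = h'[THEN bspec, THEN conjunct1] h'[THEN bspec, THEN conjunct2]
  have q: "quadratic_on C f" if C: "C \<in> \<P>" for C
  proof -
    obtain Q c \<alpha> where Q: "transpose Q = Q" "\<forall>y\<in>C. f y = (1/2) * (y \<bullet> (Q *v y)) + c \<bullet> y + \<alpha>"
      using P(4)[OF C] by blast
    have "self_adjoint ((*v) Q)"
      unfolding self_adjoint_def
      by (metis Q(1) dot_lmul_matrix matrix_vector_mul_linear vector_transpose_matrix)
    with Q(2) show ?thesis unfolding quadratic_on_def by blast
  qed
  show ?thesis
  proof (rule piecewise_quadratic_onI[of \<P> _ h])
    show "x \<in> UNIV \<longleftrightarrow> (\<exists>C\<in>\<P>. x \<in> halfspaces (h C))" for x
    proof -
      obtain C where "C \<in> \<P>" "x \<in> C" using P(2) UNIV_I[of x] by (metis UnionE)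
      then show ?thesis using h(2)[of C] by auto
    qed
  qed (use P(1) h q in simp_all)
qed

section \<open>Slope conditions and critical values of piecewise quadratic functions\<close>

lemma subspace_face_directions: "subspace (face_directions I)"
  by (fastforce simp: face_directions_def subspace_def inner_add_right)

lemma face_directions_feasible:
  assumes "finite H" "x \<in> halfspaces H" "u \<in> face_directions (active H x)"
  shows "\<forall>\<^sub>F t in at_right 0. x + t *\<^sub>R u \<in> halfspaces H"
proof -
  have "\<forall>\<^sub>F t in at_right 0. fst h \<bullet> (x + t *\<^sub>R u) \<le> snd h" if h: "h \<in> H" for h
  proof (cases "fst h \<bullet> x = snd h")
    case True
    then have "fst h \<bullet> u = 0"
      using assms(3) h by (force simp: face_directions_def active_def)
    with True show ?thesis by (simp add: inner_simps)
  next
    case False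
    then have "fst h \<bullet> x < snd h"
      using assms(2) h by (force simp: halfspaces_def)
    moreover have "((\<lambda>t. fst h \<bullet> (x + t *\<^sub>R u)) \<longlongrightarrow> fst h \<bullet> (x + 0 *\<^sub>R u)) (at_right 0)"
      by (intro tendsto_intros)
    ultimately have "\<forall>\<^sub>F t in at_right 0. fst h \<bullet> (x + t *\<^sub>R u) < snd h"
      by (intro order_tendstoD(2)) auto
    then show ?thesis by eventually_elim simp
  qed
  then have "\<forall>\<^sub>F t in at_right 0. \<forall>h\<in>H. fst h \<bullet> (x + t *\<^sub>R u) \<le> snd h"
    using assms(1) by (simp add: eventually_ball_finite)
  then show ?thesis by (auto simp: halfspaces_def split_beta)
qed

text \<open>
  The condition that plays the role of a subgradient of norm at most \<open>e\<close> at \<open>x\<close>; the quadratic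
  term leaves room for functions that are not convex.
\<close>
definition slope_at_most :: "'a::euclidean_space set \<Rightarrow> ('a \<Rightarrow> real) \<Rightarrow> 'a \<Rightarrow> real \<Rightarrow> bool" where
  "slope_at_most S f x e \<longleftrightarrow>
     (\<exists>D. \<forall>y\<in>S. f x - e * norm (y - x) - D * (norm (y - x))\<^sup>2 \<le> f y)"

text \<open>
  On a cell, a slope bound at \<open>x\<close> bounds the gradient along the minimal face containing \<open>x\<close>, since
  the directions of that face are feasible together with their negatives.
\<close>
lemma slope_bounds_face_gradient:
  assumes Q: "self_adjoint Q" and f: "\<And>y. y \<in> halfspaces H \<Longrightarrow> f y = 1/2 * (y \<bullet> Q y) + c \<bullet> y + \<alpha>"
    and "finite H" and x: "x \<in> halfspaces H" and slope: "slope_at_most (halfspaces H) f x e"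
    and u: "u \<in> face_directions (active H x)"
  shows "\<bar>(Q x + c) \<bullet> u\<bar> \<le> e * norm u"
proof -
  obtain D where D: "\<And>y. y \<in> halfspaces H \<Longrightarrow> f x - e * norm (y - x) - D * (norm (y - x))\<^sup>2 \<le> f y"
    using slope unfolding slope_at_most_def by blast
  have Ql: "linear Q" using Q by (simp add: self_adjoint_def)
  have *: "- (e * norm v) \<le> (Q x + c) \<bullet> v" if v: "v \<in> face_directions (active H x)" for v
  proof -
    have "\<forall>\<^sub>F t in at_right 0. - (e * norm v) \<le> (Q x + c) \<bullet> v + t * (1/2 * (v \<bullet> Q v) + D * (norm v)\<^sup>2)"
      using face_directions_feasible[OF assms(3) x v] eventually_at_right_less[of 0]
    proof eventually_elim
      case (elim t)
      have "f (x + t *\<^sub>R v) = f x + t * ((Q x + c) \<bullet> v) + t\<^sup>2 * (1/2 * (v \<bullet> Q v))"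
        using quadratic_expansion[OF Q, of x "t *\<^sub>R v" c \<alpha>] f[OF x] f[OF elim(1)]
        by (simp add: linear_scale[OF Ql] power2_eq_square)
      with D[OF elim(1)] elim(2)
      have "t * (- (e * norm v)) \<le> t * ((Q x + c) \<bullet> v + t * (1/2 * (v \<bullet> Q v) + D * (norm v)\<^sup>2))"
        by (simp add: power2_eq_square algebra_simps)
      with elim(2) show ?case by (metis mult_le_cancel_left_pos)
    qed
    moreover have "((\<lambda>t. (Q x + c) \<bullet> v + t * (1/2 * (v \<bullet> Q v) + D * (norm v)\<^sup>2))
        \<longlongrightarrow> (Q x + c) \<bullet> v + 0 * (1/2 * (v \<bullet> Q v) + D * (norm v)\<^sup>2)) (at_right 0)"
      by (intro tendsto_intros)
    ultimately show ?thesis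
      using tendsto_lowerbound[of _ _ "at_right (0::real)"] by fastforce
  qed
  have "- u \<in> face_directions (active H x)"
    using subspace_neg[OF subspace_face_directions u] .
  from *[OF this] *[OF u] show ?thesis by auto
qed

lemma orthogonal_projection_onto_subspace:
  fixes U :: "'a::euclidean_space set"
  assumes "subspace U"
  obtains P where "linear P" "\<And>y. P y \<in> U" "\<And>u. u \<in> U \<Longrightarrow> P u = u"
    "\<And>y u. u \<in> U \<Longrightarrow> P y \<bullet> u = y \<bullet> u" "\<And>x y. x \<bullet> P y = P x \<bullet> y"
proof -
  obtain W where W: "W \<subseteq> U" "pairwise orthogonal W" "\<And>w. w \<in> W \<Longrightarrow> norm w = 1"
    "independent W" "span W = U"
    using orthonormal_basis_subspace[OF assms] by metis
  have fin: "finite W" using W(4) independent_imp_finite by blast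
  define P where "P y = (\<Sum>w\<in>W. (y \<bullet> w) *\<^sub>R w)" for y
  have lin: "linear P"
    unfolding P_def
    by (rule linearI) (auto simp: inner_simps scaleR_left_distrib sum.distrib scaleR_sum_right)
  have PU: "P y \<in> U" for y
    unfolding P_def W(5)[symmetric] by (intro span_sum span_scale span_base)
  have basis: "P y \<bullet> w = y \<bullet> w" if "w \<in> W" for y w
  proof -
    have "(y \<bullet> v) * (v \<bullet> w) = (if v = w then y \<bullet> w else 0)" if "v \<in> W" for v
      using that \<open>w \<in> W\<close> W(2) W(3)[OF \<open>w \<in> W\<close>]
      by (auto simp: pairwise_def orthogonal_def dot_square_norm)
    then have "(\<Sum>v\<in>W. (y \<bullet> v) * (v \<bullet> w)) = (\<Sum>v\<in>W. if v = w then y \<bullet> w else 0)"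
      by (rule sum.cong[OF refl])
    then show ?thesis using fin that by (simp add: P_def inner_sum_left)
  qed
  have orth: "P y \<bullet> u = y \<bullet> u" if "u \<in> U" for y u
  proof -
    have "u \<in> span W" using that W(5) by simp
    then have "(P y - y) \<bullet> u = 0"
    proof (induction rule: span_induct_alt)
      case (step c x z)
      then show ?case using basis[of x y] by (simp add: inner_simps)
    qed simp
    then show ?thesis by (simp add: inner_simps)
  qed
  have id: "P u = u" if "u \<in> U" for u
  proof -
    have "P u - u \<in> U" using PU that assms subspace_diff by blast
    from orth[OF this, of u] have "(P u - u) \<bullet> (P u - u) = 0" by (simp add: inner_simps)
    then show ?thesis by simp
  qed
  have "x \<bullet> P y = P x \<bullet> y" for x y
    using orth[OF PU, of x y] orth[OF PU, of y x] by (simp add: inner_commute)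
  from that[OF lin PU id orth this] show thesis .
qed

text \<open>
  Along the affine set \<open>M\<close> with direction space \<open>U\<close> a quadratic is \<open>q(p + u) = q(p) + \<langle>u, L u\<rangle> / 2\<close> around a stationary point
  \<open>p\<close>, with \<open>L\<close> the compression of the Hessian, and it is controlled by the square of its gradient
  \<open>L u\<close> because \<open>u\<close> may be replaced by the image of \<open>L u\<close> under a linear pseudo-inverse of \<open>L\<close>. If no
  stationary point exists, the gradients along \<open>M\<close> form a closed set that misses \<open>0\<close>.
\<close>
lemma quadratic_face_critical_value:
  fixes Q :: "'a::euclidean_space \<Rightarrow> 'a"
  assumes Q: "self_adjoint Q" and U: "subspace U" and M: "\<And>x y. x \<in> M \<Longrightarrow> y \<in> M \<Longrightarrow> x - y \<in> U"
    and MU: "\<And>x u. x \<in> M \<Longrightarrow> u \<in> U \<Longrightarrow> x + u \<in> M"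
  shows "\<exists>\<epsilon>>0. \<exists>C\<ge>0. \<exists>v. \<forall>x\<in>M. \<forall>e. 0 \<le> e \<and> e < \<epsilon> \<and> (\<forall>u\<in>U. \<bar>(Q x + c) \<bullet> u\<bar> \<le> e * norm u)
     \<longrightarrow> \<bar>1/2 * (x \<bullet> Q x) + c \<bullet> x + \<alpha> - v\<bar> \<le> C * e\<^sup>2"
proof -
  obtain P where P: "linear P" "\<And>y. P y \<in> U" "\<And>u. u \<in> U \<Longrightarrow> P u = u"
    "\<And>y u. u \<in> U \<Longrightarrow> P y \<bullet> u = y \<bullet> u" "\<And>x y. x \<bullet> P y = P x \<bullet> y"
    using orthogonal_projection_onto_subspace[OF U] by metis
  have Ql: "linear Q" and Qs: "\<And>x y. x \<bullet> Q y = Q x \<bullet> y" using Q by (auto simp: self_adjoint_def)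
  define L where "L y = P (Q (P y))" for y
  have Ll: "linear L"
    using linear_compose[OF linear_compose[OF P(1) Ql] P(1)] by (simp add: L_def[abs_def] o_def)
  have Ls: "x \<bullet> L y = L x \<bullet> y" for x y
    by (simp add: L_def P(5) Qs)
  have grad_le: "norm (P (Q x + c)) \<le> e"
    if "0 \<le> e" and "\<forall>u\<in>U. \<bar>(Q x + c) \<bullet> u\<bar> \<le> e * norm u" for x e
  proof (cases "norm (P (Q x + c)) = 0")
    case False
    have "(norm (P (Q x + c)))\<^sup>2 = (Q x + c) \<bullet> P (Q x + c)"
      using P(4)[OF P(2), of "Q x + c" "Q x + c"] by (simp add: power2_norm_eq_inner)
    also have "\<dots> \<le> e * norm (P (Q x + c))"
      using bspec[OF that(2) P(2), of "Q x + c"] by linarith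
    finally show ?thesis using False by (simp add: power2_eq_square)
  qed (use that in simp)
  have grad_diff: "P (Q x + c) = P (Q y + c) + L (x - y)" if "x \<in> M" "y \<in> M" for x y
    using P(3)[OF M[OF that]] by (simp add: L_def linear_add[OF P(1)] linear_diff[OF P(1)] linear_diff[OF Ql])
  show ?thesis
  proof (cases "\<exists>p\<in>M. P (Q p + c) = 0")
    case True
    then obtain p where p: "p \<in> M" "P (Q p + c) = 0" by blast
    obtain h where h: "linear h" "\<And>y. L (h (L y)) = L y"
      using linear_exists_right_inverse_on[OF Ll subspace_UNIV] by auto
    obtain B where B: "B > 0" "\<And>y. norm (h y) \<le> B * norm y"
      using linear_bounded_pos[OF h(1)] by blast
    have "\<bar>1/2 * (x \<bullet> Q x) + c \<bullet> x + \<alpha> - (1/2 * (p \<bullet> Q p) + c \<bullet> p + \<alpha>)\<bar> \<le> B/2 * e\<^sup>2"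
      if "x \<in> M" "0 \<le> e" "\<forall>u\<in>U. \<bar>(Q x + c) \<bullet> u\<bar> \<le> e * norm u" for x e
    proof -
      define u where "u = x - p"
      have u: "u \<in> U" using M that(1) p(1) by (simp add: u_def)
      have e: "norm (L u) \<le> e"
        using grad_le[OF that(2,3)] grad_diff[OF that(1) p(1)] p(2) by (simp add: u_def)
      have "(Q p + c) \<bullet> u = 0" using P(4)[OF u, of "Q p + c"] p(2) by simp
      moreover have "u \<bullet> Q u = u \<bullet> L u" by (simp add: L_def P(3)[OF u] P(5))
      moreover have "x = p + u" by (simp add: u_def)
      ultimately have "1/2 * (x \<bullet> Q x) + c \<bullet> x + \<alpha> - (1/2 * (p \<bullet> Q p) + c \<bullet> p + \<alpha>) = 1/2 * (u \<bullet> L u)"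
        using quadratic_expansion[OF Q, of p u c \<alpha>] by simp
      also have "u \<bullet> L u = h (L u) \<bullet> L u" by (metis Ls h(2) inner_commute)
      finally have "\<bar>1/2 * (x \<bullet> Q x) + c \<bullet> x + \<alpha> - (1/2 * (p \<bullet> Q p) + c \<bullet> p + \<alpha>)\<bar>
          \<le> 1/2 * (norm (h (L u)) * norm (L u))"
        using Cauchy_Schwarz_ineq2[of "h (L u)" "L u"] by linarith
      also have "\<dots> \<le> 1/2 * ((B * e) * e)"
        using B e order_trans[OF B(2)[of "L u"] mult_left_mono[OF e, of B]] that(2)
        by (intro mult_left_mono mult_mono) auto
      finally show ?thesis by (simp add: power2_eq_square)
    qed
    then show ?thesis using B(1)
      by (intro exI[of _ 1] conjI exI[of _ "B/2"] exI[of _ "1/2 * (p \<bullet> Q p) + c \<bullet> p + \<alpha>"]) auto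
  next
    case no_stationary: False
    show ?thesis
    proof (cases "M = {}")
      case False
      then obtain p where p: "p \<in> M" by blast
      define G where "G = (\<lambda>y. P (Q p + c) + y) ` L ` U"
      have "closed G"
        unfolding G_def by (intro closed_translation closed_subspace linear_subspace_image Ll U)
      moreover have "0 \<notin> G"
      proof
        assume "0 \<in> G"
        then obtain u where "u \<in> U" "P (Q p + c) + L u = 0" by (auto simp: G_def)
        with grad_diff[OF MU[OF p] p, of u] MU[OF p] no_stationary show False by auto
      qed
      ultimately obtain \<epsilon> where \<epsilon>: "\<epsilon> > 0" "\<And>y. y \<in> G \<Longrightarrow> \<epsilon> \<le> dist 0 y"
        using separate_point_closed by metis
      have "\<epsilon> \<le> e" if "x \<in> M" "0 \<le> e" "\<forall>u\<in>U. \<bar>(Q x + c) \<bullet> u\<bar> \<le> e * norm u" for x e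
      proof -
        have "P (Q x + c) \<in> G"
          unfolding G_def grad_diff[OF that(1) p] using M[OF that(1) p] by blast
        then show ?thesis using \<epsilon>(2) grad_le[OF that(2,3)] by fastforce
      qed
      then show ?thesis using \<epsilon>(1) by (intro exI[of _ \<epsilon>] conjI exI[of _ 0]) force+
    qed (auto intro: exI[of _ 1])
  qed
qed

lemma slope_at_most_subset: "slope_at_most S f x e \<Longrightarrow> T \<subseteq> S \<Longrightarrow> slope_at_most T f x e"
  unfolding slope_at_most_def by blast

lemma uniform_bound_on_finitely_many_cases:
  fixes f :: "'a \<Rightarrow> real"
  assumes "finite J"
    and "\<And>j. j \<in> J \<Longrightarrow> \<exists>\<epsilon>>0. \<exists>C\<ge>0. \<exists>v. \<forall>x e. e < \<epsilon> \<and> R j x e \<longrightarrow> \<bar>f x - v\<bar> \<le> C * e\<^sup>2"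
  shows "\<exists>\<epsilon>>0. \<exists>C\<ge>0. \<exists>V. finite V \<and>
     (\<forall>x e. \<forall>j\<in>J. e < \<epsilon> \<and> R j x e \<longrightarrow> (\<exists>v\<in>V. \<bar>f x - v\<bar> \<le> C * (e::real)\<^sup>2))"
  using assms
proof (induction J rule: finite_induct)
  case empty
  then show ?case by (intro exI[of _ 1] conjI exI[of _ 0] exI[of _ "{}"]) auto
next
  case (insert j J)
  obtain \<epsilon> C V where 1: "\<epsilon> > 0" "C \<ge> 0" "finite V"
    "\<forall>x e. \<forall>j\<in>J. e < \<epsilon> \<and> R j x e \<longrightarrow> (\<exists>v\<in>V. \<bar>f x - v\<bar> \<le> C * e\<^sup>2)"
    using insert.IH insert.prems by (metis insertI2)
  obtain \<epsilon>' C' v' where 2: "\<epsilon>' > 0" "C' \<ge> 0"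
    "\<forall>x e. e < \<epsilon>' \<and> R j x e \<longrightarrow> \<bar>f x - v'\<bar> \<le> C' * e\<^sup>2"
    using insert.prems by (metis insertI1)
  have "\<exists>v\<in>insert v' V. \<bar>f x - v\<bar> \<le> (C + C') * e\<^sup>2"
    if i: "i \<in> insert j J" and e: "e < min \<epsilon> \<epsilon>'" "R i x e" for x e i
  proof (cases "i = j")
    case True
    then have "\<bar>f x - v'\<bar> \<le> C' * e\<^sup>2" using 2(3) e by simp
    also have "\<dots> \<le> (C + C') * e\<^sup>2" using 1(2) by (intro mult_right_mono) auto
    finally show ?thesis by blast
  next
    case False
    then have "\<exists>v\<in>V. \<bar>f x - v\<bar> \<le> C * e\<^sup>2" using 1(4) e i by (metis insertE min_less_iff_conj)
    then obtain v where v: "v \<in> V" "\<bar>f x - v\<bar> \<le> C * e\<^sup>2" by blast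
    note v(2)
    also have "C * e\<^sup>2 \<le> (C + C') * e\<^sup>2" using 2(2) by (intro mult_right_mono) auto
    finally show ?thesis using v(1) by blast
  qed
  with 1 2 show ?case
    by (intro exI[of _ "min \<epsilon> \<epsilon>'"] conjI exI[of _ "C + C'"] exI[of _ "insert v' V"]) auto
qed

text \<open>
  A Kurdyka-Lojasiewicz inequality with exponent \<open>1/2\<close> that is uniform over \<open>S\<close>: there are only
  finitely many pairs of a cell and a set of active constraints, and each contributes at most one
  critical value.
\<close>
lemma piecewise_quadratic_critical_values:
  assumes "piecewise_quadratic_on S f"
  shows "\<exists>\<epsilon>>0. \<exists>C\<ge>0. \<exists>V. finite V \<and>
    (\<forall>x\<in>S. \<forall>e. 0 \<le> e \<and> e < \<epsilon> \<and> slope_at_most S f x e \<longrightarrow> (\<exists>v\<in>V. \<bar>f x - v\<bar> \<le> C * e\<^sup>2))"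
proof -
  obtain \<H> where f': "finite \<H>" "\<forall>x. x \<in> S \<longleftrightarrow> (\<exists>H\<in>\<H>. x \<in> halfspaces H)"
    "\<forall>H\<in>\<H>. finite H" "\<forall>H\<in>\<H>. quadratic_on (halfspaces H) f"
    by (rule piecewise_quadratic_onE[OF assms(1)])
  note f = f'[rule_format]
  define R where "R = (\<lambda>(H, I) x e. 0 \<le> e \<and> x \<in> halfspaces H \<and> active H x = I
    \<and> slope_at_most (halfspaces H) f x e)"
  have "\<exists>\<epsilon>>0. \<exists>C\<ge>0. \<exists>V. finite V \<and>
     (\<forall>x e. \<forall>j\<in>Sigma \<H> Pow. e < \<epsilon> \<and> R j x e \<longrightarrow> (\<exists>v\<in>V. \<bar>f x - v\<bar> \<le> C * e\<^sup>2))"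
  proof (rule uniform_bound_on_finitely_many_cases)
    show "finite (Sigma \<H> Pow)" using f(1,3) by (intro finite_SigmaI) auto
    fix j assume "j \<in> Sigma \<H> Pow"
    then obtain H I where j: "j = (H, I)" "H \<in> \<H>" by auto
    obtain Q c \<alpha> where Q: "self_adjoint Q"
      and q: "\<forall>x\<in>halfspaces H. f x = 1/2 * (x \<bullet> Q x) + c \<bullet> x + \<alpha>"
      using f(4)[OF j(2)] unfolding quadratic_on_def by blast
    define M where "M = {x. \<forall>(a, \<beta>)\<in>I. a \<bullet> x = \<beta>}"
    have "\<exists>\<epsilon>>0. \<exists>C\<ge>0. \<exists>v. \<forall>x\<in>M. \<forall>e. 0 \<le> e \<and> e < \<epsilon> \<and>
        (\<forall>u\<in>face_directions I. \<bar>(Q x + c) \<bullet> u\<bar> \<le> e * norm u)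
        \<longrightarrow> \<bar>1/2 * (x \<bullet> Q x) + c \<bullet> x + \<alpha> - v\<bar> \<le> C * e\<^sup>2"
      by (rule quadratic_face_critical_value[OF Q subspace_face_directions])
        (fastforce simp: M_def face_directions_def inner_diff_right inner_add_right)+
    then obtain \<epsilon> C v where *: "\<epsilon> > 0" "C \<ge> 0"
      "\<And>x e. \<lbrakk>x \<in> M; 0 \<le> e; e < \<epsilon>; \<forall>u\<in>face_directions I. \<bar>(Q x + c) \<bullet> u\<bar> \<le> e * norm u\<rbrakk>
        \<Longrightarrow> \<bar>1/2 * (x \<bullet> Q x) + c \<bullet> x + \<alpha> - v\<bar> \<le> C * e\<^sup>2"
      by metis
    have "\<bar>f x - v\<bar> \<le> C * e\<^sup>2" if "e < \<epsilon>" "R j x e" for x e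
    proof -
      have x: "0 \<le> e" "x \<in> halfspaces H" "active H x = I" "slope_at_most (halfspaces H) f x e"
        using that(2) by (auto simp: R_def j(1))
      have "x \<in> M" using x(3) by (auto simp: M_def active_def)
      moreover have "\<forall>u\<in>face_directions I. \<bar>(Q x + c) \<bullet> u\<bar> \<le> e * norm u"
        using slope_bounds_face_gradient[OF Q _ f(3)[OF j(2)] x(2,4)] q x(3) by blast
      ultimately show ?thesis using *(3) x(1,2) that(1) q by metis
    qed
    with *(1,2) show "\<exists>\<epsilon>>0. \<exists>C\<ge>0. \<exists>v. \<forall>x e. e < \<epsilon> \<and> R j x e \<longrightarrow> \<bar>f x - v\<bar> \<le> C * e\<^sup>2"
      by blast
  qed
  then obtain \<epsilon> C V where *: "\<epsilon> > 0" "C \<ge> 0" "finite V"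
    "\<And>x e j. \<lbrakk>j \<in> Sigma \<H> Pow; e < \<epsilon>; R j x e\<rbrakk> \<Longrightarrow> \<exists>v\<in>V. \<bar>f x - v\<bar> \<le> C * e\<^sup>2"
    by metis
  have "\<exists>v\<in>V. \<bar>f x - v\<bar> \<le> C * e\<^sup>2"
    if x: "x \<in> S" and e: "0 \<le> e" "e < \<epsilon>" "slope_at_most S f x e" for x e
  proof -
    obtain H where H: "H \<in> \<H>" "x \<in> halfspaces H" using f(2) x by blast
    have "slope_at_most (halfspaces H) f x e"
      using slope_at_most_subset[OF e(3)] f(2) H(1) by blast
    then have "R (H, active H x) x e" using e(1) H(2) by (simp add: R_def)
    moreover have "(H, active H x) \<in> Sigma \<H> Pow" using H(1) by (auto simp: active_def)
    ultimately show ?thesis using *(4) e(2) by blast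
  qed
  then show ?thesis using *(1-3) by blast
qed

text \<open>
  The values of a descent sequence converge, and the steps tend to zero, so the critical value
  selected at \<open>x\<^sub>k\<close> is eventually the limit \<open>f\<^sup>*\<close> of the values. Then
  \<open>f(x\<^sub>k\<^sub>+\<^sub>1) - f\<^sup>*\<close> is bounded by the squared step, hence by the decrease
  \<open>f(x\<^sub>k) - f(x\<^sub>k\<^sub>+\<^sub>1)\<close>, and the values contract geometrically.
\<close>
lemma piecewise_quadratic_descent_steps_geometric:
  fixes x :: "nat \<Rightarrow> 'a::euclidean_space"
  assumes pq: "piecewise_quadratic_on S f" and xS: "\<And>k. x k \<in> S"
    and c: "c > 0" and descent: "\<And>k. c * (norm (x (Suc k) - x k))\<^sup>2 \<le> f (x k) - f (x (Suc k))"
    and below: "\<And>k. m \<le> f (x k)"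
    and L: "L \<ge> 0" and slope: "\<And>k. slope_at_most S f (x (Suc k)) (L * norm (x (Suc k) - x k))"
  shows "\<exists>K q. 0 < q \<and> q < 1 \<and> (\<forall>k. norm (x (Suc k) - x k) \<le> K * q ^ k)"
proof -
  define s where "s k = norm (x (Suc k) - x k)" for k
  have dec: "f (x (Suc k)) \<le> f (x k)" for k
    using descent[of k] c by (smt (verit) mult_nonneg_nonneg zero_le_power2)
  have "decseq (\<lambda>k. f (x k))" by (rule decseq_SucI) (rule dec)
  then obtain v where v: "(\<lambda>k. f (x k)) \<longlonglongrightarrow> v" "\<And>k. v \<le> f (x k)"
    using decseq_convergent[of "\<lambda>k. f (x k)" m] below by metis
  have v': "(\<lambda>k. f (x (Suc k))) \<longlonglongrightarrow> v" using LIMSEQ_Suc[OF v(1)] .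
  have s2: "(s k)\<^sup>2 \<le> (f (x k) - f (x (Suc k))) / c" for k
    using descent[of k] c by (simp add: s_def pos_le_divide_eq mult.commute)
  have "(\<lambda>k. (f (x k) - f (x (Suc k))) / c) \<longlonglongrightarrow> (v - v) / c"
    by (intro tendsto_intros v(1) v') (use c in simp)
  then have up: "(\<lambda>k. (f (x k) - f (x (Suc k))) / c) \<longlonglongrightarrow> 0" by simp
  have "(\<lambda>k. (s k)\<^sup>2) \<longlonglongrightarrow> 0"
    by (rule tendsto_sandwich[OF _ _ tendsto_const up]) (simp_all add: s2)
  from tendsto_real_sqrt[OF this] have s0: "s \<longlonglongrightarrow> 0"
    by (simp add: s_def[abs_def])
  obtain \<epsilon> C V where V: "\<epsilon> > 0" "C \<ge> 0" "finite V"
    "\<And>x e. \<lbrakk>x \<in> S; 0 \<le> e; e < \<epsilon>; slope_at_most S f x e\<rbrakk> \<Longrightarrow> \<exists>v\<in>V. \<bar>f x - v\<bar> \<le> C * e\<^sup>2"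
    using piecewise_quadratic_critical_values[OF pq] by metis
  obtain \<delta> where \<delta>: "\<delta> > 0" "\<And>w. w \<in> V \<Longrightarrow> w \<noteq> v \<Longrightarrow> \<delta> \<le> dist v w"
    using finite_set_avoid[OF V(3), of v] by metis
  have l1: "(\<lambda>k. L * s k) \<longlonglongrightarrow> L * 0" and l2: "(\<lambda>k. C * (L * s k)\<^sup>2) \<longlonglongrightarrow> C * (L * 0)\<^sup>2"
    by (intro tendsto_intros s0)+
  have "\<forall>\<^sub>F k in sequentially. L * s k < \<epsilon>" "\<forall>\<^sub>F k in sequentially. C * (L * s k)\<^sup>2 < \<delta> / 2"
    "\<forall>\<^sub>F k in sequentially. f (x (Suc k)) < v + \<delta> / 2"
    using order_tendstoD(2)[OF l1, of \<epsilon>] order_tendstoD(2)[OF l2, of "\<delta> / 2"]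
      order_tendstoD(2)[OF v', of "v + \<delta> / 2"] V(1) \<delta>(1) by simp_all
  then have "\<forall>\<^sub>F k in sequentially. f (x (Suc k)) - v \<le> C * (L * s k)\<^sup>2"
  proof eventually_elim
    case (elim k)
    obtain w where w: "w \<in> V" "\<bar>f (x (Suc k)) - w\<bar> \<le> C * (L * s k)\<^sup>2"
      using V(4)[OF xS _ elim(1) slope[of k, folded s_def]] L by (auto simp: s_def)
    have "\<bar>v - w\<bar> < \<delta>" using w(2) elim(2,3) v(2)[of "Suc k"] by linarith
    then have "w = v" using \<delta>(2)[OF w(1)] by (force simp: dist_real_def)
    with w(2) show ?case by linarith
  qed
  then obtain N where N: "\<And>k. k \<ge> N \<Longrightarrow> f (x (Suc k)) - v \<le> C * (L * s k)\<^sup>2"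
    unfolding eventually_sequentially by blast
  \<comment> \<open>The summand \<open>1\<close> keeps the contraction factor \<open>\<theta>\<close> positive when \<open>C\<close> or \<open>L\<close> is zero.\<close>
  define \<kappa> where "\<kappa> = C * L\<^sup>2 / c + 1"
  have \<kappa>: "\<kappa> > 0" using V(2) c by (auto simp: \<kappa>_def intro: add_nonneg_pos)
  define \<theta> where "\<theta> = \<kappa> / (1 + \<kappa>)"
  have \<theta>: "0 < \<theta>" "\<theta> < 1" using \<kappa> by (auto simp: \<theta>_def)
  have contract: "f (x (Suc k)) - v \<le> \<theta> * (f (x k) - v)" if "k \<ge> N" for k
  proof -
    have "f (x (Suc k)) - v \<le> C * L\<^sup>2 * (s k)\<^sup>2"
      using N[OF that] by (simp add: power_mult_distrib)
    also have "\<dots> \<le> C * L\<^sup>2 * ((f (x k) - f (x (Suc k))) / c)"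
      using V(2) s2 by (intro mult_left_mono) auto
    also have "\<dots> \<le> \<kappa> * (f (x k) - f (x (Suc k)))"
      using dec[of k] by (simp add: \<kappa>_def algebra_simps)
    finally have "(1 + \<kappa>) * (f (x (Suc k)) - v) \<le> \<kappa> * (f (x k) - v)"
      by (simp add: algebra_simps)
    then show ?thesis using \<kappa> by (simp add: \<theta>_def pos_le_divide_eq mult.commute)
  qed
  have geo: "f (x (N + k)) - v \<le> \<theta> ^ k * (f (x N) - v)" for k
  proof (induction k)
    case (Suc k)
    have "f (x (N + Suc k)) - v \<le> \<theta> * (f (x (N + k)) - v)" using contract[of "N + k"] by simp
    also have "\<dots> \<le> \<theta> * (\<theta> ^ k * (f (x N) - v))" using Suc \<theta> by (intro mult_left_mono) auto
    finally show ?case by simp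
  qed simp
  define q where "q = sqrt \<theta>"
  have q: "0 < q" "q < 1" using \<theta> by (auto simp: q_def)
  have qk: "sqrt (\<theta> ^ k) = q ^ k" for k by (simp add: q_def real_sqrt_power)
  define B where "B = sqrt ((f (x N) - v) / c)"
  have tail: "s (N + k) \<le> B * q ^ k" for k
  proof -
    have "(s (N + k))\<^sup>2 \<le> (f (x (N + k)) - v) / c"
      using s2[of "N + k"] v(2)[of "Suc (N + k)"] c by (smt (verit) divide_right_mono)
    also have "\<dots> \<le> (f (x N) - v) / c * \<theta> ^ k"
      using geo[of k] c by (simp add: divide_right_mono mult.commute)
    finally have "sqrt ((s (N + k))\<^sup>2) \<le> sqrt ((f (x N) - v) / c * \<theta> ^ k)"
      by (rule real_sqrt_le_mono)
    moreover have "sqrt ((f (x N) - v) / c * \<theta> ^ k) = B * q ^ k"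
      unfolding B_def qk[symmetric] by (rule real_sqrt_mult)
    ultimately show ?thesis by (simp add: s_def)
  qed
  \<comment> \<open>The sum makes the bound hold for the finitely many steps before \<open>N\<close> as well.\<close>
  define K where "K = B / q ^ N + (\<Sum>k<N. s k / q ^ k)"
  have pos: "s k / q ^ k \<ge> 0" for k using q by (simp add: s_def)
  have B: "B \<ge> 0" using v(2) c by (simp add: B_def)
  have "s k \<le> K * q ^ k" for k
  proof (cases "k < N")
    case True
    then have "s k / q ^ k \<le> (\<Sum>k<N. s k / q ^ k)"
      using pos by (intro member_le_sum) auto
    also have "\<dots> \<le> K" using B q by (simp add: K_def)
    finally show ?thesis using q by (simp add: pos_divide_le_eq)
  next
    case False
    then obtain j where j: "k = N + j" using le_Suc_ex not_less by blast
    have "s k \<le> B * q ^ j" using tail j by simp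
    also have "\<dots> = B / q ^ N * q ^ k" using q by (simp add: j power_add)
    also have "\<dots> \<le> K * q ^ k"
      using q sum_nonneg[of "{..<N}" "\<lambda>k. s k / q ^ k"] pos by (intro mult_right_mono) (auto simp: K_def)
    finally show ?thesis .
  qed
  then show ?thesis using q unfolding s_def by blast
qed

text \<open>
  Consider a cell and an active set that occur for infinitely many \<open>x\<^sub>k\<close>. The limit \<open>p\<close> satisfies
  the same active constraints, so \<open>x\<^sub>k - p\<close> is a direction of that face, and the gradient at \<open>p\<close>
  vanishes along it. Hence the linear term of \<open>f\<close> along the segment from \<open>p\<close> to \<open>x\<^sub>k\<close> is zero.
\<close>
lemma piecewise_quadratic_radially_homogeneous:
  fixes x :: "nat \<Rightarrow> 'a::euclidean_space"
  assumes pq: "piecewise_quadratic_on S f" and xS: "\<And>k. x k \<in> S" and lim: "x \<longlonglongrightarrow> p"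
    and slope: "\<And>k. slope_at_most S f (x k) (e k)" and e0: "e \<longlonglongrightarrow> 0"
  shows "\<forall>\<^sub>F k in sequentially. \<forall>t\<in>{0..1}. f (p + t *\<^sub>R (x k - p)) = f p + t\<^sup>2 * (f (x k) - f p)"
proof -
  obtain \<H> where f': "finite \<H>" "\<forall>x. x \<in> S \<longleftrightarrow> (\<exists>H\<in>\<H>. x \<in> halfspaces H)"
    "\<forall>H\<in>\<H>. finite H" "\<forall>H\<in>\<H>. quadratic_on (halfspaces H) f"
    by (rule piecewise_quadratic_onE[OF pq])
  note f = f'[rule_format]
  define T where "T j k \<longleftrightarrow> x k \<in> halfspaces (fst j) \<and> active (fst j) (x k) = snd j" for j k
  define goal where "goal k \<longleftrightarrow> (\<forall>t\<in>{0..1}. f (p + t *\<^sub>R (x k - p)) = f p + t\<^sup>2 * (f (x k) - f p))"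
    for k
  have "\<forall>\<^sub>F k in sequentially. T j k \<longrightarrow> goal k" if j: "j \<in> Sigma \<H> Pow" for j
  proof (cases "finite {k. T j k}")
    case True
    then obtain n where "\<forall>k\<in>{k. T j k}. k < n" using finite_nat_set_iff_bounded by metis
    then show ?thesis unfolding eventually_sequentially by (intro exI[of _ n]) force
  next
    case False
    obtain H I where HI: "j = (H, I)" "H \<in> \<H>" using j by auto
    obtain Q c \<alpha> where Q: "self_adjoint Q"
      and q: "\<And>x. x \<in> halfspaces H \<Longrightarrow> f x = 1/2 * (x \<bullet> Q x) + c \<bullet> x + \<alpha>"
      using f(4)[OF HI(2)] unfolding quadratic_on_def by blast
    have Ql: "linear Q" using Q by (simp add: self_adjoint_def)
    obtain r :: "nat \<Rightarrow> nat" where r: "strict_mono r" "\<And>n. T j (r n)"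
      using infinite_enumerate[OF False] by auto
    have y: "x (r n) \<in> halfspaces H" "active H (x (r n)) = I" for n
      using r(2)[of n] by (auto simp: T_def HI(1))
    have ylim: "(\<lambda>n. x (r n)) \<longlonglongrightarrow> p" and elim0: "(\<lambda>n. e (r n)) \<longlonglongrightarrow> 0"
      using LIMSEQ_subseq_LIMSEQ[OF lim r(1)] LIMSEQ_subseq_LIMSEQ[OF e0 r(1)] by (auto simp: o_def)
    have pH: "p \<in> halfspaces H"
      using closed_sequentially[OF closed_halfspaces y(1) ylim] .
    have pI: "a \<bullet> p = \<beta>" if "(a, \<beta>) \<in> I" for a \<beta>
    proof -
      have "(\<lambda>n. a \<bullet> x (r n)) \<longlonglongrightarrow> a \<bullet> p" by (intro tendsto_intros ylim)
      moreover have "a \<bullet> x (r n) = \<beta>" for n using that y(2)[of n] by (auto simp: active_def)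
      ultimately show ?thesis by (simp add: LIMSEQ_const_iff)
    qed
    have stationary: "(Q p + c) \<bullet> u = 0" if u: "u \<in> face_directions I" for u
    proof -
      have "\<bar>(Q (x (r n)) + c) \<bullet> u\<bar> \<le> e (r n) * norm u" for n
      proof (rule slope_bounds_face_gradient[OF Q q f(3)[OF HI(2)] y(1)])
        show "slope_at_most (halfspaces H) f (x (r n)) (e (r n))"
          by (rule slope_at_most_subset[OF slope]) (use f(2) HI(2) in blast)
      qed (use u y(2) in simp_all)
      moreover have "(\<lambda>n. \<bar>(Q (x (r n)) + c) \<bullet> u\<bar>) \<longlonglongrightarrow> \<bar>(Q p + c) \<bullet> u\<bar>"
        by (intro tendsto_intros bounded_linear.tendsto[OF _ ylim]) (use Ql in \<open>simp add: linear_conv_bounded_linear\<close>)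
      moreover have "(\<lambda>n. e (r n) * norm u) \<longlonglongrightarrow> 0 * norm u" by (intro tendsto_intros elim0)
      ultimately have "\<bar>(Q p + c) \<bullet> u\<bar> \<le> 0 * norm u" by (intro LIMSEQ_le[of _ _ "\<lambda>n. e (r n) * norm u"]) auto
      then show ?thesis by simp
    qed
    have "goal k" if "T j k" for k
    proof -
      define u where "u = x k - p"
      have xk: "x k \<in> halfspaces H" "active H (x k) = I" using that by (auto simp: T_def HI(1))
      have u: "u \<in> face_directions I"
        using pI xk(2) by (fastforce simp: u_def face_directions_def active_def inner_diff_right)
      have radial: "f (p + t *\<^sub>R u) = f p + t\<^sup>2 * (1/2 * (u \<bullet> Q u))" if t: "t \<in> {0..1}" for t
      proof -
        have "p + t *\<^sub>R u = (1 - t) *\<^sub>R p + t *\<^sub>R x k" by (simp add: u_def algebra_simps)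
        then have "p + t *\<^sub>R u \<in> halfspaces H"
          using convexD_alt[OF convex_halfspaces pH xk(1)] t by auto
        then show ?thesis
          using quadratic_expansion[OF Q, of p "t *\<^sub>R u" c \<alpha>] q[OF pH] q stationary[OF u]
          by (simp add: linear_scale[OF Ql] power2_eq_square)
      qed
      have "1/2 * (u \<bullet> Q u) = f (x k) - f p" using radial[of 1] by (simp add: u_def)
      with radial show ?thesis unfolding goal_def u_def[symmetric] by simp
    qed
    then show ?thesis by (simp add: always_eventually)
  qed
  moreover have "finite (Sigma \<H> Pow)" using f(1,3) by (intro finite_SigmaI) auto
  ultimately have "\<forall>\<^sub>F k in sequentially. \<forall>j\<in>Sigma \<H> Pow. T j k \<longrightarrow> goal k"
    by (intro eventually_ball_finite) blast+
  then show ?thesis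
  proof eventually_elim
    case (elim k)
    obtain H where H: "H \<in> \<H>" "x k \<in> halfspaces H" using f(2)[of "x k"] xS[of k] by blast
    then have "(H, active H (x k)) \<in> Sigma \<H> Pow" "T (H, active H (x k)) k"
      by (auto simp: active_def T_def)
    with elim show ?case unfolding goal_def by blast
  qed
qed

section \<open>A nonlinear power method\<close>

text \<open>
  The step \<open>d\<^sub>k\<^sub>+\<^sub>1\<close> minimizes \<open>G(y) - B(d\<^sub>k, y)\<close>, as in the power method for the pencil of the
  quadratic-like functions \<open>S(d) = B(d, d) / 2\<close> and \<open>G\<close>. The quotient \<open>R\<^sub>k = S(d\<^sub>k) / G(d\<^sub>k)\<close>
  increases, by at least a multiple of \<open>(\<parallel>R\<^sub>k d\<^sub>k - d\<^sub>k\<^sub>+\<^sub>1\<parallel> / \<parallel>d\<^sub>k\<parallel>)\<^sup>2\<close>: this follows on comparing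
  the minimum with the point \<open>R\<^sub>k d\<^sub>k\<close> and on using a Cauchy-Schwarz inequality for \<open>B\<close>. Since
  \<open>G - S\<close> decreases to zero along the sequence, \<open>R\<^sub>k \<le> 1\<close>. Hence \<open>R\<^sub>k\<close> converges, the ratio of consecutive norms has the
  same limit, and geometric decay forces this limit to be at most \<open>q\<close>.
\<close>
lemma nonlinear_power_method_Q_linear:
  fixes d :: "nat \<Rightarrow> 'a::real_normed_vector" and G :: "'a \<Rightarrow> real" and B :: "'a \<Rightarrow> 'a \<Rightarrow> real"
  assumes m: "m > 0"
    and hom: "\<And>k t. 0 \<le> t \<Longrightarrow> t \<le> 1 \<Longrightarrow> G (t *\<^sub>R d k) = t\<^sup>2 * G (d k)"
    and lin: "\<And>k t. B (d k) (t *\<^sub>R d k) = t * B (d k) (d k)"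
    and opt: "\<And>k t. 0 \<le> t \<Longrightarrow> t \<le> 1 \<Longrightarrow>
      G (d (Suc k)) - B (d k) (d (Suc k)) + m * (norm (t *\<^sub>R d k - d (Suc k)))\<^sup>2
        \<le> G (t *\<^sub>R d k) - B (d k) (t *\<^sub>R d k)"
    and cs: "\<And>k \<sigma>. \<sigma> \<ge> 0 \<Longrightarrow>
      2 * \<sigma> * B (d k) (d (Suc k)) \<le> \<sigma>\<^sup>2 * B (d k) (d k) + B (d (Suc k)) (d (Suc k))"
    and Bpos: "\<And>k. 0 < B (d k) (d k)" and Bup: "\<And>k. B (d k) (d k) \<le> C * (norm (d k))\<^sup>2"
    and Gpos: "\<And>k. 0 < G (d k)" and G0: "(\<lambda>k. G (d k)) \<longlonglongrightarrow> 0"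
    and q: "0 < q" "q < 1" and geo: "\<And>k. norm (d k) \<le> K * q ^ k"
    and nz: "\<And>k. d k \<noteq> 0"
  shows "\<exists>c. 0 < c \<and> c < 1 \<and> (\<forall>\<^sub>F k in sequentially. norm (d (Suc k)) \<le> c * norm (d k))"
proof -
  define g where "g k = G (d k)" for k
  define s where "s k = B (d k) (d k)" for k
  define b where "b k = B (d k) (d (Suc k))" for k
  have g: "g k > 0" and s: "s k > 0" for k using Gpos Bpos by (auto simp: g_def s_def)
  have opt': "g (Suc k) - b k + m * (norm (t *\<^sub>R d k - d (Suc k)))\<^sup>2 \<le> t\<^sup>2 * g k - t * s k"
    if "0 \<le> t" "t \<le> 1" for t k
    using opt[OF that, of k] hom[OF that] lin by (simp add: g_def s_def b_def)
  have cs': "2 * \<sigma> * b k \<le> \<sigma>\<^sup>2 * s k + s (Suc k)" if "\<sigma> \<ge> 0" for \<sigma> k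
    using cs[OF that] by (simp add: s_def b_def)
  have C: "C > 0"
    using Bpos[of 0] Bup[of 0] zero_le_power2[of "norm (d 0)"]
    by (smt (verit) mult_nonneg_nonneg mult_nonpos_nonneg)
  have d0: "d \<longlonglongrightarrow> 0"
  proof (rule Lim_null_comparison)
    show "\<forall>\<^sub>F k in sequentially. norm (d k) \<le> K * q ^ k" by (simp add: geo)
    have "(\<lambda>k. K * q ^ k) \<longlonglongrightarrow> K * 0" using q by (intro tendsto_intros LIMSEQ_power_zero) auto
    then show "(\<lambda>k. K * q ^ k) \<longlonglongrightarrow> 0" by simp
  qed
  have s0: "s \<longlonglongrightarrow> 0"
  proof (rule tendsto_sandwich[OF _ _ tendsto_const])
    show "\<forall>\<^sub>F k in sequentially. 0 \<le> s k" using s by (simp add: less_imp_le)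
    show "\<forall>\<^sub>F k in sequentially. s k \<le> C * (norm (d k))\<^sup>2" by (simp add: s_def Bup)
    have "(\<lambda>k. C * (norm (d k))\<^sup>2) \<longlonglongrightarrow> C * (norm (0::'a))\<^sup>2" by (intro tendsto_intros d0)
    then show "(\<lambda>k. C * (norm (d k))\<^sup>2) \<longlonglongrightarrow> 0" by simp
  qed
  define R where "R k = s k / (2 * g k)" for k
  have Rpos: "R k > 0" for k using g s by (simp add: R_def)
  have R1: "R k \<le> 1" for k
  proof -
    \<comment> \<open>Descent of \<open>G - S\<close>: compare the minimum with \<open>d\<^sub>k\<close> itself, and use \<open>cs\<close> with \<open>\<sigma> = 1\<close>.\<close>
    have "decseq (\<lambda>k. g k - s k / 2)"
    proof (rule decseq_SucI)
      fix k
      have "0 \<le> m * (norm (1 *\<^sub>R d k - d (Suc k)))\<^sup>2" using m by simp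
      then show "g (Suc k) - s (Suc k) / 2 \<le> g k - s k / 2"
        using opt'[of 1 k] cs'[of 1 k] by simp
    qed
    moreover have "(\<lambda>k. g k - s k / 2) \<longlonglongrightarrow> 0 - 0 / 2"
      by (intro tendsto_intros s0) (use G0 in \<open>simp add: g_def\<close>, simp)
    ultimately have "0 \<le> g k - s k / 2" using decseq_ge by fastforce
    then show ?thesis using g[of k] by (simp add: R_def)
  qed
  have step: "2 * m * (norm (R k *\<^sub>R d k - d (Suc k)))\<^sup>2 \<le> s k * (R (Suc k) - R k)" for k
  proof -
    \<comment> \<open>\<open>R\<^sub>k\<close> is the minimizer of \<open>G(t d\<^sub>k) - B(d\<^sub>k, t d\<^sub>k)\<close> over \<open>t\<close>, and \<open>\<sigma>\<close> below is the best choice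
      in \<open>cs\<close> when \<open>B(d\<^sub>k, d\<^sub>k\<^sub>+\<^sub>1)\<close> has its extremal value \<open>2 G(d\<^sub>k\<^sub>+\<^sub>1)\<close>.\<close>
    define z where "z = m * (norm (R k *\<^sub>R d k - d (Suc k)))\<^sup>2"
    have "(R k)\<^sup>2 * g k - R k * s k = - (R k * s k / 2)"
      using g[of k] by (simp add: R_def power2_eq_square field_simps)
    then have 1: "R k * s k / 2 + z \<le> b k - g (Suc k)"
      using opt'[of "R k" k] Rpos[of k] R1[of k] by (simp add: z_def)
    define \<sigma> where "\<sigma> = 2 * g (Suc k) / s k"
    have \<sigma>: "\<sigma> > 0" "\<sigma> * s k = 2 * g (Suc k)" using g[of "Suc k"] s[of k] by (auto simp: \<sigma>_def)
    have "2 * \<sigma> * (R k * s k / 2 + z) \<le> 2 * \<sigma> * (b k - g (Suc k))"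
      using 1 \<sigma>(1) by (intro mult_left_mono) auto
    also have "\<dots> = 2 * \<sigma> * b k - \<sigma>\<^sup>2 * s k"
      by (simp add: power2_eq_square mult.assoc \<sigma>(2) algebra_simps)
    also have "\<dots> \<le> s (Suc k)" using cs'[of \<sigma> k] \<sigma>(1) by simp
    finally have "R k * (\<sigma> * s k) + 2 * \<sigma> * z \<le> s (Suc k)"
      by (simp add: algebra_simps)
    then have "2 * g (Suc k) * R k + 2 * \<sigma> * z \<le> s (Suc k)"
      unfolding \<sigma>(2) by (simp add: algebra_simps)
    moreover have "s (Suc k) = 2 * g (Suc k) * R (Suc k)" using g[of "Suc k"] by (simp add: R_def)
    ultimately have "2 * \<sigma> * z \<le> 2 * g (Suc k) * (R (Suc k) - R k)"
      by (simp add: algebra_simps)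
    also have "\<dots> = \<sigma> * (s k * (R (Suc k) - R k))" using \<sigma>(2) by simp
    finally show ?thesis using \<sigma>(1) by (simp add: z_def)
  qed
  have Rmono: "R k \<le> R (Suc k)" for k
  proof -
    have "0 \<le> s k * (R (Suc k) - R k)" using step[of k] m by (smt (verit) mult_nonneg_nonneg zero_le_power2)
    then show ?thesis using s[of k] by (simp add: zero_le_mult_iff)
  qed
  obtain \<tau> where \<tau>: "R \<longlonglongrightarrow> \<tau>" "\<And>k. R k \<le> \<tau>"
    using incseq_convergent[of R 1] incseq_SucI[of R] Rmono R1 by blast
  define \<eta> where "\<eta> k = sqrt (C / (2 * m) * (R (Suc k) - R k))" for k
  have "\<eta> \<longlonglongrightarrow> sqrt (C / (2 * m) * (\<tau> - \<tau>))"
    unfolding \<eta>_def by (intro tendsto_intros \<tau>(1) LIMSEQ_Suc)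
  then have \<eta>0: "\<eta> \<longlonglongrightarrow> 0" by simp
  have near: "norm (R k *\<^sub>R d k - d (Suc k)) \<le> \<eta> k * norm (d k)" for k
  proof -
    have "2 * m * (norm (R k *\<^sub>R d k - d (Suc k)))\<^sup>2 \<le> C * (norm (d k))\<^sup>2 * (R (Suc k) - R k)"
      using step[of k] mult_right_mono[OF Bup[of k], of "R (Suc k) - R k"] Rmono[of k]
      by (simp add: s_def)
    then have "(norm (R k *\<^sub>R d k - d (Suc k)))\<^sup>2 \<le> C / (2 * m) * (R (Suc k) - R k) * (norm (d k))\<^sup>2"
      using m by (simp add: field_simps)
    then have "norm (R k *\<^sub>R d k - d (Suc k))
        \<le> sqrt (C / (2 * m) * (R (Suc k) - R k) * (norm (d k))\<^sup>2)"
      by (rule real_le_rsqrt)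
    also have "\<dots> = \<eta> k * norm (d k)"
      unfolding \<eta>_def real_sqrt_mult[of _ "(norm (d k))\<^sup>2"] by simp
    finally show ?thesis .
  qed
  have upper: "norm (d (Suc k)) \<le> (R k + \<eta> k) * norm (d k)"
    and lower: "(R k - \<eta> k) * norm (d k) \<le> norm (d (Suc k))" for k
    using near[of k] norm_triangle_ineq2[of "d (Suc k)" "R k *\<^sub>R d k"]
      norm_triangle_ineq2[of "R k *\<^sub>R d k" "d (Suc k)"] Rpos[of k]
    by (simp_all add: norm_minus_commute algebra_simps)
  \<comment> \<open>If \<open>\<tau> > q\<close>, the norms would eventually decay no faster than \<open>p\<^sup>k\<close> with \<open>p > q\<close>.\<close>
  have "\<tau> \<le> q"
  proof (rule ccontr)
    assume "\<not> \<tau> \<le> q"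
    then obtain p where p: "q < p" "p < \<tau>" using dense not_le by metis
    have "(\<lambda>k. R k - \<eta> k) \<longlonglongrightarrow> \<tau> - 0" by (intro tendsto_intros \<tau> \<eta>0)
    then have "\<forall>\<^sub>F k in sequentially. p < R k - \<eta> k" using p(2) by (intro order_tendstoD(1)) auto
    then obtain N where N: "\<And>k. k \<ge> N \<Longrightarrow> p < R k - \<eta> k" unfolding eventually_sequentially by blast
    have "norm (d N) * p ^ j \<le> norm (d (N + j))" for j
    proof (induction j)
      case (Suc j)
      have "norm (d N) * p ^ Suc j \<le> p * norm (d (N + j))"
        using Suc p q by simp
      also have "\<dots> \<le> (R (N + j) - \<eta> (N + j)) * norm (d (N + j))"
        using N[of "N + j"] by (intro mult_right_mono) auto
      also have "\<dots> \<le> norm (d (N + Suc j))" using lower[of "N + j"] by simp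
      finally show ?case .
    qed simp
    then have "norm (d N) * p ^ j \<le> K * q ^ (N + j)" for j using geo order_trans by blast
    then have "norm (d N) \<le> K * q ^ N * (q / p) ^ j" for j
      using p q by (simp add: power_add power_divide pos_le_divide_eq mult.assoc)
    moreover have "(\<lambda>j. K * q ^ N * (q / p) ^ j) \<longlonglongrightarrow> K * q ^ N * 0"
      using p q by (intro tendsto_intros LIMSEQ_power_zero) auto
    ultimately have "norm (d N) \<le> K * q ^ N * 0" by (intro LIMSEQ_le_const) auto
    then show False using nz[of N] by simp
  qed
  define c where "c = (1 + q) / 2"
  have c: "0 < c" "c < 1" using q by (auto simp: c_def)
  have "\<forall>\<^sub>F k in sequentially. \<eta> k < (1 - q) / 2" using \<eta>0 q by (intro order_tendstoD(2)) auto
  then have "\<forall>\<^sub>F k in sequentially. norm (d (Suc k)) \<le> c * norm (d k)"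
  proof eventually_elim
    case (elim k)
    have "R k + \<eta> k \<le> c" using elim \<tau>(2)[of k] \<open>\<tau> \<le> q\<close> by (simp add: c_def field_simps)
    then have "(R k + \<eta> k) * norm (d k) \<le> c * norm (d k)" by (rule mult_right_mono) simp
    with upper[of k] show ?case by linarith
  qed
  with c show ?thesis by blast
qed

section \<open>The conjugate function and its derivative\<close>

text \<open>The derivative of \<open>psi_star a\<close>: an affine function clamped to \<open>[0, 1]\<close>.\<close>

definition weight :: "real \<Rightarrow> real \<Rightarrow> real" where
  "weight a s = max 0 (min 1 (((a + 1) * s - 2) / (2 * (a - 1))))"

lemma weight_bounds: "0 \<le> weight a s" "weight a s \<le> 1"
  by (auto simp: weight_def)

lemma weight_eq_0: "a > 1 \<Longrightarrow> s \<le> 2 / (a + 1) \<Longrightarrow> weight a s = 0"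
  by (simp add: weight_def field_simps)

lemma weight_eq_1: "a > 1 \<Longrightarrow> 2 * a / (a + 1) \<le> s \<Longrightarrow> weight a s = 1"
  by (simp add: weight_def field_simps)

lemma weight_Lipschitz:
  assumes "a > 1"
  shows "\<bar>weight a s - weight a t\<bar> \<le> (a + 1) / (2 * (a - 1)) * \<bar>s - t\<bar>"
proof -
  have "\<bar>weight a s - weight a t\<bar> \<le> \<bar>((a + 1) * s - 2) / (2 * (a - 1)) - ((a + 1) * t - 2) / (2 * (a - 1))\<bar>"
    by (simp add: weight_def)
  also have "((a + 1) * s - 2) / (2 * (a - 1)) - ((a + 1) * t - 2) / (2 * (a - 1))
      = (a + 1) / (2 * (a - 1)) * (s - t)"
    by (simp add: diff_divide_distrib[symmetric] right_diff_distrib)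
  finally show ?thesis using assms by (simp add: abs_mult)
qed

text \<open>The weight is the maximizer in the definition of the conjugate.\<close>

lemma psi_star_attained:
  assumes "a > 1"
  shows "psi_star a s = s * weight a s - phi a (weight a s)"
proof -
  consider "s \<le> 2 / (a + 1)" | "2 / (a + 1) < s" "s \<le> 2 * a / (a + 1)" | "2 * a / (a + 1) < s"
    by linarith
  then show ?thesis
  proof cases
    case 1
    then show ?thesis using weight_eq_0[OF assms 1] by (simp add: psi_star_def phi_def)
  next
    case 2
    define w where "w = ((a + 1) * s - 2) / (2 * (a - 1))"
    have "0 \<le> w" "w \<le> 1" using 2 assms by (auto simp: w_def field_simps)
    then have w: "weight a s = w" by (simp add: weight_def w_def)
    have sw: "(a + 1) * s - 2 = 2 * (a - 1) * w" using assms by (simp add: w_def)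
    then have s: "(2 * (a - 1) * w + 2) / (a + 1) = s" using assms by (simp add: field_simps)
    have a: "a\<^sup>2 - 1 = (a - 1) * (a + 1)" by (simp add: power2_eq_square algebra_simps)
    have "psi_star a s = ((a + 1) * s - 2)\<^sup>2 / (4 * (a\<^sup>2 - 1))" using 2 by (simp add: psi_star_def)
    also have "\<dots> = (2 * (a - 1) * w)\<^sup>2 / (4 * ((a - 1) * (a + 1)))" by (simp only: sw a)
    also have "\<dots> = (2 * (a - 1) * w + 2) / (a + 1) * w - phi a w"
      using assms by (simp add: phi_def power2_eq_square divide_simps) (simp add: algebra_simps)
    finally show ?thesis unfolding s w .
  next
    case 3
    have "2 / (a + 1) < 2 * a / (a + 1)" using assms by (simp add: divide_strict_right_mono)
    moreover have "phi a 1 = 1"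
      using assms by (simp add: phi_def add_divide_distrib[symmetric])
    ultimately show ?thesis using 3 weight_eq_1[OF assms, of s] by (simp add: psi_star_def)
  qed
qed

lemma psi_star_upper_bound:
  assumes "a > 1" "0 \<le> t" "t \<le> 1"
  shows "s * t - phi a t \<le> psi_star a s"
proof -
  have "ereal (s * t) - psi a t \<le> conjugate (psi a) s"
    unfolding conjugate_def by (rule SUP_upper) simp
  then show ?thesis using assms by (simp add: conjugate_psi[OF assms(1)] psi_def)
qed

lemma psi_star_support:
  assumes "a > 1"
  shows "psi_star a s + weight a s * (t - s) \<le> psi_star a t"
  using psi_star_upper_bound[OF assms weight_bounds, of t a s] psi_star_attained[OF assms, of s]
  by (simp add: algebra_simps)

text \<open>
  Together with the support inequality, this bound gives both the derivative of the conjugate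
  function and the second-order tightness of the majorization.
\<close>

lemma psi_star_quadratic_upper:
  assumes "a > 1"
  shows "psi_star a t \<le> psi_star a s + weight a s * (t - s) + (a + 1) / (2 * (a - 1)) * (t - s)\<^sup>2"
proof -
  have "psi_star a t \<le> psi_star a s + weight a t * (t - s)"
    using psi_star_support[OF assms, of t s] by (simp add: algebra_simps)
  moreover have "(weight a t - weight a s) * (t - s) \<le> (a + 1) / (2 * (a - 1)) * (t - s)\<^sup>2"
  proof -
    have "(weight a t - weight a s) * (t - s) \<le> \<bar>weight a t - weight a s\<bar> * \<bar>t - s\<bar>"
      by (metis abs_ge_self abs_mult)
    also have "\<dots> \<le> (a + 1) / (2 * (a - 1)) * \<bar>t - s\<bar> * \<bar>t - s\<bar>"
      by (intro mult_right_mono weight_Lipschitz assms) auto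
    finally show ?thesis by (simp add: power2_eq_square mult.assoc)
  qed
  ultimately show ?thesis by (simp add: algebra_simps)
qed

lemma has_real_derivative_psi_star:
  assumes "a > 1"
  shows "(psi_star a has_real_derivative weight a s) (at s)"
proof -
  define L where "L = (a + 1) / (2 * (a - 1))"
  have "\<bar>(psi_star a t - psi_star a s) / (t - s) - weight a s\<bar> \<le> L * \<bar>t - s\<bar>" if "t \<noteq> s" for t
  proof -
    have "\<bar>psi_star a t - psi_star a s - weight a s * (t - s)\<bar> \<le> L * \<bar>t - s\<bar> * \<bar>t - s\<bar>"
      using psi_star_support[OF assms, of s t] psi_star_quadratic_upper[OF assms, of t s]
      by (simp add: L_def power2_eq_square mult.assoc)
    moreover have "(psi_star a t - psi_star a s) / (t - s) - weight a s
        = (psi_star a t - psi_star a s - weight a s * (t - s)) / (t - s)"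
      using that by (simp add: field_simps)
    ultimately show ?thesis using that by (simp add: abs_divide pos_divide_le_eq)
  qed
  then have bound: "\<forall>\<^sub>F t in at s. norm ((psi_star a t - psi_star a s) / (t - s) - weight a s) \<le> L * \<bar>t - s\<bar>"
    by (auto simp: eventually_at_filter)
  have "((\<lambda>t. L * \<bar>t - s\<bar>) \<longlongrightarrow> L * \<bar>s - s\<bar>) (at s)" by (intro tendsto_intros)
  then have "((\<lambda>t. L * \<bar>t - s\<bar>) \<longlongrightarrow> 0) (at s)" by simp
  from Lim_null_comparison[OF bound this] show ?thesis
    unfolding has_field_derivative_iff by (rule LIM_zero_cancel)
qed

lemma w_rho_nth: "a > 1 \<Longrightarrow> w_rho a \<rho> x $ i = weight a (\<rho> * \<bar>x $ i\<bar>)"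
  by (simp add: w_rho_def DERIV_imp_deriv[OF has_real_derivative_psi_star])

lemma psi_star_nonpos: "a > 1 \<Longrightarrow> s \<le> 0 \<Longrightarrow> psi_star a s = 0"
  by (simp add: psi_star_def) (smt (verit) divide_nonneg_nonneg)

lemma psi_star_le_self:
  assumes "a > 1" "s \<ge> 0"
  shows "psi_star a s \<le> s"
proof -
  have "psi_star a s \<le> weight a s * s"
    using psi_star_support[OF assms(1), of s 0] psi_star_nonpos[OF assms(1), of 0] by simp
  also have "\<dots> \<le> 1 * s" using weight_bounds assms(2) by (intro mult_right_mono) auto
  finally show ?thesis by simp
qed

lemma quadratic_on_real:
  fixes f :: "real \<Rightarrow> real"
  assumes "\<And>x. x \<in> C \<Longrightarrow> f x = \<alpha> * x\<^sup>2 + \<beta> * x + \<gamma>"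
  shows "quadratic_on C f"
proof -
  have "quadratic_on C (\<lambda>x. \<alpha> * (norm x)\<^sup>2 + (\<beta> \<bullet> x + \<gamma>))"
    by (intro quadratic_on_add quadratic_on_scale quadratic_on_norm_power2 quadratic_on_inner)
  moreover have "\<alpha> * (norm x)\<^sup>2 + (\<beta> \<bullet> x + \<gamma>) = f x" if "x \<in> C" for x
    using assms[OF that] by simp
  ultimately show ?thesis using quadratic_on_cong[of C] by (metis (no_types, lifting))
qed

lemma piecewise_quadratic_psi_star:
  assumes "a > 1"
  shows "piecewise_quadratic_on UNIV (psi_star a)"
proof -
  define H :: "nat \<Rightarrow> (real \<times> real) set" where
    "H i = (if i = 0 then {(1, 2 / (a + 1))}
            else if i = 1 then {(-1, - (2 / (a + 1))), (1, 2 * a / (a + 1))}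
            else {(-1, - (2 * a / (a + 1)))})" for i
  have H: "halfspaces (H 0) = {..2 / (a + 1)}" "halfspaces (H 1) = {2 / (a + 1)..2 * a / (a + 1)}"
    "halfspaces (H 2) = {2 * a / (a + 1)..}"
    by (auto simp: halfspaces_def H_def)
  have lt: "2 / (a + 1) < 2 * a / (a + 1)" using assms by (simp add: divide_strict_right_mono)
  show ?thesis
  proof (rule piecewise_quadratic_onI[of "{0, 1, 2}" _ H])
    show "x \<in> UNIV \<longleftrightarrow> (\<exists>i\<in>{0, 1, 2}. x \<in> halfspaces (H i))" for x
      using lt by (auto simp: H simp del: One_nat_def)
    fix i :: nat assume "i \<in> {0, 1, 2}"
    then consider "i = 0" | "i = 1" | "i = 2" by auto
    then show "quadratic_on (halfspaces (H i)) (psi_star a)"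
    proof cases
      case 1
      show ?thesis unfolding 1 H
        by (rule quadratic_on_real[of _ _ 0 0 0]) (auto simp: psi_star_def)
    next
      case 2
      show ?thesis unfolding 2 H
      proof (rule quadratic_on_real[of _ _ "(a + 1)\<^sup>2 / (4 * (a\<^sup>2 - 1))"
            "- (4 * (a + 1)) / (4 * (a\<^sup>2 - 1))" "4 / (4 * (a\<^sup>2 - 1))"])
        fix x assume x: "x \<in> {2 / (a + 1)..2 * a / (a + 1)}"
        have "psi_star a x = ((a + 1) * x - 2)\<^sup>2 / (4 * (a\<^sup>2 - 1))"
        proof (cases "x = 2 / (a + 1)")
          case True
          then have "(a + 1) * x = 2" using assms by (simp add: field_simps)
          with True show ?thesis by (simp add: psi_star_def)
        qed (use x in \<open>simp add: psi_star_def\<close>)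
        also have "\<dots> = ((a + 1)\<^sup>2 * x\<^sup>2 + - (4 * (a + 1)) * x + 4) / (4 * (a\<^sup>2 - 1))"
          by (simp add: power2_eq_square algebra_simps)
        finally show "psi_star a x = (a + 1)\<^sup>2 / (4 * (a\<^sup>2 - 1)) * x\<^sup>2
            + - (4 * (a + 1)) / (4 * (a\<^sup>2 - 1)) * x + 4 / (4 * (a\<^sup>2 - 1))"
          by (simp only: add_divide_distrib times_divide_eq_left)
      qed
    next
      case 3
      have "psi_star a x = 0 * x\<^sup>2 + 1 * x + - 1" if "x \<in> {2 * a / (a + 1)..}" for x
        using psi_star_attained[OF assms, of x] weight_eq_1[OF assms, of x] that assms
        by (simp add: phi_def add_divide_distrib[symmetric])
      then show ?thesis unfolding 3 H by (rule quadratic_on_real)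
    qed
  qed (auto simp: H_def)
qed

lemma piecewise_quadratic_abs: "piecewise_quadratic_on UNIV (\<lambda>t::real. \<bar>t\<bar>)"
proof (rule piecewise_quadratic_onI[of "{-1, 1}" _ "\<lambda>\<sigma>. {(\<sigma>, 0)}"])
  fix \<sigma> :: real assume "\<sigma> \<in> {-1, 1}"
  then show "quadratic_on (halfspaces {(\<sigma>, 0)}) (\<lambda>t::real. \<bar>t\<bar>)"
    by (intro quadratic_on_real[of _ _ 0 "-\<sigma>" 0]) (auto simp: halfspaces_def)
qed (auto simp: halfspaces_def)

text \<open>
  The weight is a clamped affine function, so near any point its increment is linear on either
  side; the two slopes differ exactly at the two points where the clamp sets in.
\<close>
lemma weight_locally_homogeneous:
  assumes "a > 1"
  shows "\<exists>\<epsilon>>0. \<exists>\<kappa> \<kappa>'. 0 \<le> \<kappa> \<and> 0 \<le> \<kappa>' \<and>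
    (\<forall>u. \<bar>u\<bar> < \<epsilon> \<longrightarrow> weight a (s + u) - weight a s = (if 0 \<le> u then \<kappa> else \<kappa>') * u)"
proof -
  define \<alpha> where "\<alpha> = (a + 1) / (2 * (a - 1))"
  define v where "v = ((a + 1) * s - 2) / (2 * (a - 1))"
  have \<alpha>: "\<alpha> > 0" using assms by (simp add: \<alpha>_def)
  have w: "weight a (s + u) = max 0 (min 1 (v + \<alpha> * u))" for u
  proof -
    have "((a + 1) * (s + u) - 2) / D = ((a + 1) * s - 2) / D + (a + 1) / D * u" for D
      by (simp add: add_divide_distrib[symmetric] distrib_left)
    then show ?thesis by (simp add: weight_def v_def \<alpha>_def)
  qed
  have small: "\<bar>\<alpha> * u\<bar> < \<delta>" if "\<bar>u\<bar> < \<delta> / \<alpha>" for u \<delta>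
    using that \<alpha> by (simp add: abs_mult pos_less_divide_eq mult.commute)
  have sgn: "0 \<le> \<alpha> * u" if "0 \<le> u" for u using that \<alpha> by simp
  have sgn': "\<alpha> * u < 0" if "u < 0" for u using that \<alpha> by (simp add: mult_pos_neg)
  have w0: "weight a s = max 0 (min 1 v)" using w[of 0] by simp
  have concl: ?thesis if "\<epsilon> > 0" "0 \<le> \<kappa>" "0 \<le> \<kappa>'"
    "\<forall>u. \<bar>u\<bar> < \<epsilon> \<longrightarrow> weight a (s + u) - weight a s = (if 0 \<le> u then \<kappa> else \<kappa>') * u" for \<epsilon> \<kappa> \<kappa>'
    using that by blast
  consider "v < 0" | "v = 0" | "0 < v" "v < 1" | "v = 1" | "1 < v" by linarith
  then show ?thesis
  proof cases
    case 1
    have *: "weight a (s + u) - weight a s = (if 0 \<le> u then 0 else 0) * u" if "\<bar>u\<bar> < (-v) / \<alpha>" for u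
      using small[OF that] sgn[of u] sgn'[of u] 1 unfolding w w0
      by (cases "0 \<le> u") (simp_all add: max_def min_def)
    show ?thesis
      by (rule concl[OF _ _ _ allI[OF impI[OF *]]]) (use 1 \<alpha> in \<open>simp_all add: divide_neg_pos\<close>)
  next
    case 2
    have *: "weight a (s + u) - weight a s = (if 0 \<le> u then \<alpha> else 0) * u" if "\<bar>u\<bar> < 1 / \<alpha>" for u
      using small[OF that] sgn[of u] sgn'[of u] 2 unfolding w w0
      by (cases "0 \<le> u") (simp_all add: max_def min_def)
    show ?thesis
      by (rule concl[OF _ _ _ allI[OF impI[OF *]]]) (use 2 \<alpha> in \<open>simp_all add: divide_neg_pos\<close>)
  next
    case 3
    have *: "weight a (s + u) - weight a s = (if 0 \<le> u then \<alpha> else \<alpha>) * u" if "\<bar>u\<bar> < min v (1 - v) / \<alpha>" for u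
      using small[OF that] sgn[of u] sgn'[of u] 3 unfolding w w0
      by (cases "0 \<le> u") (simp_all add: max_def min_def split: if_splits)
    show ?thesis
      by (rule concl[OF _ _ _ allI[OF impI[OF *]]]) (use 3 \<alpha> in \<open>simp_all add: divide_neg_pos\<close>)
  next
    case 4
    have *: "weight a (s + u) - weight a s = (if 0 \<le> u then 0 else \<alpha>) * u" if "\<bar>u\<bar> < 1 / \<alpha>" for u
      using small[OF that] sgn[of u] sgn'[of u] 4 unfolding w w0
      by (cases "0 \<le> u") (simp_all add: max_def min_def)
    show ?thesis
      by (rule concl[OF _ _ _ allI[OF impI[OF *]]]) (use 4 \<alpha> in \<open>simp_all add: divide_neg_pos\<close>)
  next
    case 5
    have *: "weight a (s + u) - weight a s = (if 0 \<le> u then 0 else 0) * u" if "\<bar>u\<bar> < (v - 1) / \<alpha>" for u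
      using small[OF that] sgn[of u] sgn'[of u] 5 unfolding w w0
      by (cases "0 \<le> u") (simp_all add: max_def min_def)
    show ?thesis
      by (rule concl[OF _ _ _ allI[OF impI[OF *]]]) (use 5 \<alpha> in \<open>simp_all add: divide_neg_pos\<close>)
  qed
qed

text \<open>
  In this form the weighted \<open>\<ell>\<^sub>1\<close> term of the model depends on the position of its centre. At \<open>t = 0\<close> the kink of the absolute
  value is harmless because the weight vanishes near \<open>0\<close>.
\<close>
lemma weight_abs_locally_bilinear:
  assumes "a > 1" "\<rho> > 0"
  shows "\<exists>\<epsilon>>0. \<exists>\<kappa> \<kappa>'. 0 \<le> \<kappa> \<and> 0 \<le> \<kappa>' \<and> (\<forall>u v. \<bar>u\<bar> < \<epsilon> \<longrightarrow> \<bar>v\<bar> < \<epsilon> \<longrightarrow>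
    (weight a (\<rho> * \<bar>t + u\<bar>) - weight a (\<rho> * \<bar>t\<bar>)) * (\<bar>t + v\<bar> - \<bar>t\<bar>) = (if 0 \<le> u then \<kappa> else \<kappa>') * u * v)"
proof (cases "t = 0")
  case True
  define \<epsilon> where "\<epsilon> = 2 / (a + 1) / \<rho>"
  have "weight a (\<rho> * \<bar>u\<bar>) = 0" if "\<bar>u\<bar> < \<epsilon>" for u
  proof (rule weight_eq_0[OF assms(1)])
    have "\<bar>u\<bar> * \<rho> < 2 / (a + 1)" using that assms(2) unfolding \<epsilon>_def by (simp only: pos_less_divide_eq)
    then show "\<rho> * \<bar>u\<bar> \<le> 2 / (a + 1)" by (simp add: mult.commute)
  qed
  moreover have "\<epsilon> > 0" "weight a 0 = 0" using assms by (auto simp: \<epsilon>_def intro!: weight_eq_0)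
  ultimately show ?thesis using True by (intro exI[of _ \<epsilon>] conjI exI[of _ 0]) auto
next
  case False
  obtain \<epsilon> \<kappa> \<kappa>' where *: "\<epsilon> > 0" "0 \<le> \<kappa>" "0 \<le> \<kappa>'"
    "\<And>u. \<bar>u\<bar> < \<epsilon> \<Longrightarrow> weight a (\<rho> * \<bar>t\<bar> + u) - weight a (\<rho> * \<bar>t\<bar>) = (if 0 \<le> u then \<kappa> else \<kappa>') * u"
    using weight_locally_homogeneous[OF assms(1), of "\<rho> * \<bar>t\<bar>"] by metis
  define \<eta> where "\<eta> = min \<bar>t\<bar> (\<epsilon> / \<rho>)"
  have \<eta>: "\<eta> > 0" "\<eta> \<le> \<bar>t\<bar>" using False *(1) assms(2) by (auto simp: \<eta>_def)
  have small: "\<bar>\<rho> * u\<bar> < \<epsilon>" if "\<bar>u\<bar> < \<eta>" for u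
    using that assms(2) by (simp add: \<eta>_def abs_mult pos_less_divide_eq mult.commute)
  show ?thesis
  proof (cases "t > 0")
    case True
    have "(weight a (\<rho> * \<bar>t + u\<bar>) - weight a (\<rho> * \<bar>t\<bar>)) * (\<bar>t + v\<bar> - \<bar>t\<bar>)
        = (if 0 \<le> u then \<rho> * \<kappa> else \<rho> * \<kappa>') * u * v" if "\<bar>u\<bar> < \<eta>" "\<bar>v\<bar> < \<eta>" for u v
    proof -
      have "\<rho> * \<bar>t + u\<bar> = \<rho> * \<bar>t\<bar> + \<rho> * u" "\<bar>t + v\<bar> - \<bar>t\<bar> = v"
        using that \<eta>(2) True by (auto simp: algebra_simps)
      then show ?thesis using *(4)[OF small[OF that(1)]] assms(2) by (simp add: zero_le_mult_iff)
    qed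
    then show ?thesis using \<eta>(1) * assms(2)
      by (intro exI[of _ \<eta>] conjI exI[of _ "\<rho> * \<kappa>"] exI[of _ "\<rho> * \<kappa>'"]) auto
  next
    case neg: False
    have "(weight a (\<rho> * \<bar>t + u\<bar>) - weight a (\<rho> * \<bar>t\<bar>)) * (\<bar>t + v\<bar> - \<bar>t\<bar>)
        = (if 0 \<le> u then \<rho> * \<kappa>' else \<rho> * \<kappa>) * u * v" if "\<bar>u\<bar> < \<eta>" "\<bar>v\<bar> < \<eta>" for u v
    proof -
      have 1: "\<rho> * \<bar>t + u\<bar> = \<rho> * \<bar>t\<bar> + \<rho> * (- u)" and 2: "\<bar>t + v\<bar> - \<bar>t\<bar> = - v"
        using that \<eta>(2) neg False by (auto simp: algebra_simps abs_if)
      have "\<bar>- u\<bar> < \<eta>" using that(1) by simp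
      from *(4)[OF small[OF this]] have "weight a (\<rho> * \<bar>t\<bar> + \<rho> * (- u)) - weight a (\<rho> * \<bar>t\<bar>)
          = (if u \<le> 0 then \<kappa> else \<kappa>') * (\<rho> * (- u))"
        using assms(2) by (simp add: mult_le_0_iff)
      then show ?thesis unfolding 1 2 by (cases "u = 0") auto
    qed
    then show ?thesis using \<eta>(1) * assms(2)
      by (intro exI[of _ \<eta>] conjI exI[of _ "\<rho> * \<kappa>'"] exI[of _ "\<rho> * \<kappa>"]) auto
  qed
qed

section \<open>Strongly convex minimization\<close>

lemma norm_convex_combination_power2:
  fixes x y :: "'a::real_inner"
  shows "(norm ((1 - t) *\<^sub>R x + t *\<^sub>R y))\<^sup>2
    = (1 - t) * (norm x)\<^sup>2 + t * (norm y)\<^sup>2 - t * (1 - t) * (norm (y - x))\<^sup>2"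
  by (simp only: power2_norm_eq_inner inner_add_left inner_add_right inner_diff_left inner_diff_right
      inner_scaleR_left inner_scaleR_right inner_commute[of y x]) (simp add: algebra_simps)

lemma convex_on_norm_affine_power2:
  fixes L :: "'a::real_vector \<Rightarrow> 'b::real_inner"
  assumes "linear L"
  shows "convex_on UNIV (\<lambda>y. (norm (L y - v))\<^sup>2)"
proof (rule convex_onI)
  fix t :: real and x y
  assume t: "0 < t" "t < 1"
  have "L ((1 - t) *\<^sub>R x + t *\<^sub>R y) - v = (1 - t) *\<^sub>R (L x - v) + t *\<^sub>R (L y - v)"
    by (simp add: linear_add[OF assms] linear_scale[OF assms]) (simp add: algebra_simps)
  moreover have "0 \<le> t * (1 - t) * (norm ((L y - v) - (L x - v)))\<^sup>2" using t by simp
  ultimately show "(norm (L ((1 - t) *\<^sub>R x + t *\<^sub>R y) - v))\<^sup>2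
      \<le> (1 - t) * (norm (L x - v))\<^sup>2 + t * (norm (L y - v))\<^sup>2"
    by (simp only: norm_convex_combination_power2)
qed simp

text \<open>Compare \<open>x\<close> with the points \<open>(1 - t) x + t y\<close> and let \<open>t\<close> tend to \<open>0\<close>.\<close>

lemma minimizer_quadratic_growth:
  fixes h :: "'a::real_inner \<Rightarrow> real"
  assumes conv: "convex_on S (\<lambda>y. h y - \<mu> / 2 * (norm y)\<^sup>2)"
    and x: "x \<in> S" and min: "\<And>y. y \<in> S \<Longrightarrow> h x \<le> h y" and y: "y \<in> S"
  shows "h x + \<mu> / 2 * (norm (y - x))\<^sup>2 \<le> h y"
proof -
  have S: "convex S" using conv by (simp add: convex_on_def)
  have *: "h x + \<mu> / 2 * (1 - t) * (norm (y - x))\<^sup>2 \<le> h y" if t: "0 < t" "t < 1" for t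
  proof -
    define p where "p = (1 - t) *\<^sub>R x + t *\<^sub>R y"
    have "p \<in> S" unfolding p_def using convexD_alt[OF S x y] t by simp
    have "h p - \<mu> / 2 * (norm p)\<^sup>2
        \<le> (1 - t) * (h x - \<mu> / 2 * (norm x)\<^sup>2) + t * (h y - \<mu> / 2 * (norm y)\<^sup>2)"
      unfolding p_def using convex_onD[OF conv, of t x y] t x y by simp
    moreover have "(norm p)\<^sup>2 = (1 - t) * (norm x)\<^sup>2 + t * (norm y)\<^sup>2 - t * (1 - t) * (norm (y - x))\<^sup>2"
      unfolding p_def by (rule norm_convex_combination_power2)
    ultimately have "h p \<le> (1 - t) * h x + t * h y - \<mu> / 2 * (t * (1 - t) * (norm (y - x))\<^sup>2)"
      by (simp add: field_simps)
    with min[OF \<open>p \<in> S\<close>] have "t * h x + \<mu> / 2 * (t * (1 - t) * (norm (y - x))\<^sup>2) \<le> t * h y"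
      unfolding left_diff_distrib[of 1 t "h x"] by linarith
    then have "t * (h x + \<mu> / 2 * (1 - t) * (norm (y - x))\<^sup>2) \<le> t * h y"
      by (simp only: distrib_left mult_ac)
    with t show ?thesis by simp
  qed
  have "\<forall>\<^sub>F t in at_right 0. h x + \<mu> / 2 * (1 - t) * (norm (y - x))\<^sup>2 \<le> h y"
    using eventually_at_right_real[of 0 1] by (rule eventually_mono) (use * in auto)
  moreover have "((\<lambda>t. h x + \<mu> / 2 * (1 - t) * (norm (y - x))\<^sup>2)
      \<longlongrightarrow> h x + \<mu> / 2 * (1 - 0) * (norm (y - x))\<^sup>2) (at_right 0)"
    by (intro tendsto_intros)
  ultimately have "h x + \<mu> / 2 * (1 - 0) * (norm (y - x))\<^sup>2 \<le> h y"
    by (intro tendsto_upperbound[OF _ _ trivial_limit_at_right_real])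
  then show ?thesis by simp
qed

lemma abs_vec_nth: "\<bar>x :: real ^ 'n\<bar> $ i = \<bar>x $ i\<bar>"
  by (simp add: abs_vec_def)

lemma norm_abs_vec_diff: "norm (\<bar>x\<bar> - \<bar>y :: real ^ 'n\<bar>) \<le> norm (x - y)"
  by (rule norm_le_componentwise_cart) (simp add: abs_vec_nth)

lemma norm_power2_vec: "(norm (x :: real ^ 'n))\<^sup>2 = (\<Sum>i\<in>UNIV. (x $ i)\<^sup>2)"
  by (simp add: norm_vec_def L2_set_def sum_nonneg)

section \<open>The surrogate problem and its majorizing models\<close>

locale surrogate =
  fixes f :: "real ^ 'n \<Rightarrow> real" and A :: "real ^ 'p ^ 'n" and b :: "real ^ 'n"
    and \<Omega> :: "(real ^ 'p) set" and \<mu> a lam \<rho> g1 g2 :: real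
  assumes f_plq: "piecewise_linear_quadratic f" and f_convex: "convex_on UNIV f"
    and f_nonneg: "\<And>y. f y \<ge> 0"
    and \<Omega>_polyhedron: "polyhedron \<Omega>"
    and \<mu>: "\<mu> > 0" and a: "a > 1" and lam: "lam > 0" and \<rho>: "\<rho> > 0" and g1: "g1 > 0" and g2: "g2 > 0"
begin

abbreviation F :: "real ^ 'p \<Rightarrow> real" where "F \<equiv> F_reg f A b \<mu>"
abbreviation W :: "real ^ 'p \<Rightarrow> real ^ 'p" where "W \<equiv> w_rho a \<rho>"
abbreviation model :: "real ^ 'p \<Rightarrow> real ^ 'p \<Rightarrow> real" where
  "model \<equiv> MM_model f A b \<mu> a lam \<rho> g1 g2"

definition theta :: "real ^ 'p \<Rightarrow> real" where
  "theta x = F x + lam * norm_1 x - lam * inverse \<rho> * (\<Sum>i\<in>UNIV. psi_star a (\<rho> * \<bar>x $ i\<bar>))"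

text \<open>
  Lipschitz constants: \<open>lip_W\<close> of the weights as a function of the centre, \<open>lip_model\<close> of the
  difference of two models as a multiple of the distance of their centres.
\<close>

definition lip_W :: real where "lip_W = (a + 1) / (2 * (a - 1)) * \<rho>"

definition op_A :: real where "op_A = onorm ((*v) A)"

definition lip_model :: real where "lip_model = lam * lip_W + g1 + g2 * op_A\<^sup>2"

lemma Theta_eq: "Theta f A b \<Omega> \<mu> a lam \<rho> x = (if x \<in> \<Omega> then ereal (theta x) else \<infinity>)"
  by (simp add: Theta_def delta_def theta_def)

lemma lip_W_nonneg: "lip_W \<ge> 0" using a \<rho> by (simp add: lip_W_def)

lemma norm_A: "norm (A *v x) \<le> op_A * norm x"
  unfolding op_A_def by (rule onorm) simp

lemma op_A_nonneg: "op_A \<ge> 0" unfolding op_A_def by (rule onorm_pos_le) simp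

lemma lip_model_nonneg: "lip_model \<ge> 0"
  using lam g1 g2 lip_W_nonneg by (simp add: lip_model_def)

lemma inner_A: "\<bar>(A *v x) \<bullet> (A *v y)\<bar> \<le> op_A\<^sup>2 * (norm x * norm y)"
proof -
  have "\<bar>(A *v x) \<bullet> (A *v y)\<bar> \<le> norm (A *v x) * norm (A *v y)" by (rule Cauchy_Schwarz_ineq2)
  also have "\<dots> \<le> (op_A * norm x) * (op_A * norm y)"
    by (intro mult_mono norm_A mult_nonneg_nonneg op_A_nonneg norm_ge_zero)
  finally show ?thesis by (simp add: power2_eq_square mult_ac)
qed

lemma A_power2: "(norm (A *v x))\<^sup>2 \<le> op_A\<^sup>2 * (norm x)\<^sup>2"
  using power_mono[OF norm_A, of x 2] by (simp add: power_mult_distrib)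

lemma W_nth: "W x $ i = weight a (\<rho> * \<bar>x $ i\<bar>)"
  by (rule w_rho_nth[OF a])

lemma norm_W_diff: "norm (W x - W y) \<le> lip_W * norm (x - y)"
proof -
  have "norm (W x - W y) \<le> norm (lip_W *\<^sub>R (x - y))"
  proof (rule norm_le_componentwise_cart)
    fix i
    have "\<bar>W x $ i - W y $ i\<bar> \<le> (a + 1) / (2 * (a - 1)) * \<bar>\<rho> * \<bar>x $ i\<bar> - \<rho> * \<bar>y $ i\<bar>\<bar>"
      unfolding W_nth by (rule weight_Lipschitz[OF a])
    also have "\<bar>\<rho> * \<bar>x $ i\<bar> - \<rho> * \<bar>y $ i\<bar>\<bar> = \<rho> * \<bar>\<bar>x $ i\<bar> - \<bar>y $ i\<bar>\<bar>"
      using \<rho> by (simp add: right_diff_distrib[symmetric] abs_mult)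
    also have "(a + 1) / (2 * (a - 1)) * \<dots> \<le> (a + 1) / (2 * (a - 1)) * (\<rho> * \<bar>x $ i - y $ i\<bar>)"
      using a \<rho> by (intro mult_left_mono) auto
    finally have "\<bar>W x $ i - W y $ i\<bar> \<le> lip_W * \<bar>x $ i - y $ i\<bar>" by (simp add: lip_W_def)
    then show "norm ((W x - W y) $ i) \<le> norm ((lip_W *\<^sub>R (x - y)) $ i)"
      using lip_W_nonneg by (simp add: abs_mult)
  qed
  then show ?thesis using lip_W_nonneg by simp
qed

lemma inner_W_diff: "\<bar>(W z - W p) \<bullet> (\<bar>x\<bar> - \<bar>y\<bar>)\<bar> \<le> lip_W * (norm (z - p) * norm (x - y))"
proof -
  have "\<bar>(W z - W p) \<bullet> (\<bar>x\<bar> - \<bar>y\<bar>)\<bar> \<le> norm (W z - W p) * norm (\<bar>x\<bar> - \<bar>y\<bar>)"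
    by (rule Cauchy_Schwarz_ineq2)
  also have "\<dots> \<le> lip_W * norm (z - p) * norm (x - y)"
    by (intro mult_mono norm_W_diff norm_abs_vec_diff mult_nonneg_nonneg lip_W_nonneg norm_ge_zero)
  finally show ?thesis by (simp add: mult.assoc)
qed

text \<open>
  As a function of \<open>|x|\<close>, the regularizer is concave with derivative \<open>\<lambda> (1 - w\<^sub>i)\<close>; the first bound
  is the majorization, the second one says that it is tight up to second order.
\<close>
lemma theta_upper: "theta y - theta z \<le> F y - F z + lam * ((1 - W z) \<bullet> (\<bar>y\<bar> - \<bar>z\<bar>))"
proof -
  have "(\<Sum>i\<in>UNIV. lam * \<bar>y $ i\<bar> - lam * inverse \<rho> * psi_star a (\<rho> * \<bar>y $ i\<bar>)
      - (lam * \<bar>z $ i\<bar> - lam * inverse \<rho> * psi_star a (\<rho> * \<bar>z $ i\<bar>)))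
      \<le> (\<Sum>i\<in>UNIV. lam * ((1 - W z $ i) * (\<bar>y $ i\<bar> - \<bar>z $ i\<bar>)))"
  proof (rule sum_mono)
    fix i
    have "inverse \<rho> * (W z $ i * (\<rho> * \<bar>y $ i\<bar> - \<rho> * \<bar>z $ i\<bar>))
        \<le> inverse \<rho> * (psi_star a (\<rho> * \<bar>y $ i\<bar>) - psi_star a (\<rho> * \<bar>z $ i\<bar>))"
      using psi_star_support[OF a, of "\<rho> * \<bar>z $ i\<bar>" "\<rho> * \<bar>y $ i\<bar>"] \<rho>
      by (intro mult_left_mono) (auto simp: W_nth)
    moreover have "inverse \<rho> * (W z $ i * (\<rho> * \<bar>y $ i\<bar> - \<rho> * \<bar>z $ i\<bar>)) = W z $ i * (\<bar>y $ i\<bar> - \<bar>z $ i\<bar>)"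
      using \<rho> by (simp add: field_simps)
    ultimately have "lam * (W z $ i * (\<bar>y $ i\<bar> - \<bar>z $ i\<bar>))
        \<le> lam * (inverse \<rho> * (psi_star a (\<rho> * \<bar>y $ i\<bar>) - psi_star a (\<rho> * \<bar>z $ i\<bar>)))"
      using lam by (intro mult_left_mono) auto
    then show "lam * \<bar>y $ i\<bar> - lam * inverse \<rho> * psi_star a (\<rho> * \<bar>y $ i\<bar>)
        - (lam * \<bar>z $ i\<bar> - lam * inverse \<rho> * psi_star a (\<rho> * \<bar>z $ i\<bar>))
        \<le> lam * ((1 - W z $ i) * (\<bar>y $ i\<bar> - \<bar>z $ i\<bar>))"
      by (simp add: algebra_simps)
  qed
  then show ?thesis
    by (simp add: theta_def norm_1_def inner_vec_def abs_vec_nth sum_distrib_left sum_subtractf)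
qed

lemma theta_lower:
  "F y - F p + lam * ((1 - W p) \<bullet> (\<bar>y\<bar> - \<bar>p\<bar>)) - lam * lip_W * (norm (y - p))\<^sup>2 \<le> theta y - theta p"
proof -
  have "(\<Sum>i\<in>UNIV. lam * ((1 - W p $ i) * (\<bar>y $ i\<bar> - \<bar>p $ i\<bar>)) - lam * lip_W * (\<bar>y $ i\<bar> - \<bar>p $ i\<bar>)\<^sup>2)
      \<le> (\<Sum>i\<in>UNIV. lam * \<bar>y $ i\<bar> - lam * inverse \<rho> * psi_star a (\<rho> * \<bar>y $ i\<bar>)
      - (lam * \<bar>p $ i\<bar> - lam * inverse \<rho> * psi_star a (\<rho> * \<bar>p $ i\<bar>)))"
  proof (rule sum_mono)
    fix i
    define L where "L = (a + 1) / (2 * (a - 1))"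
    have "inverse \<rho> * (psi_star a (\<rho> * \<bar>y $ i\<bar>) - psi_star a (\<rho> * \<bar>p $ i\<bar>))
        \<le> inverse \<rho> * (W p $ i * (\<rho> * \<bar>y $ i\<bar> - \<rho> * \<bar>p $ i\<bar>) + L * (\<rho> * \<bar>y $ i\<bar> - \<rho> * \<bar>p $ i\<bar>)\<^sup>2)"
      using psi_star_quadratic_upper[OF a, of "\<rho> * \<bar>y $ i\<bar>" "\<rho> * \<bar>p $ i\<bar>"] \<rho>
      by (intro mult_left_mono) (auto simp: W_nth L_def)
    also have "\<dots> = W p $ i * (\<bar>y $ i\<bar> - \<bar>p $ i\<bar>) + lip_W * (\<bar>y $ i\<bar> - \<bar>p $ i\<bar>)\<^sup>2"
      unfolding lip_W_def L_def[symmetric] right_diff_distrib[of \<rho>, symmetric]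
      using \<rho> by (simp add: power2_eq_square field_simps)
    finally have "lam * (inverse \<rho> * (psi_star a (\<rho> * \<bar>y $ i\<bar>) - psi_star a (\<rho> * \<bar>p $ i\<bar>)))
        \<le> lam * (W p $ i * (\<bar>y $ i\<bar> - \<bar>p $ i\<bar>) + lip_W * (\<bar>y $ i\<bar> - \<bar>p $ i\<bar>)\<^sup>2)"
      using lam by (intro mult_left_mono) auto
    then show "lam * ((1 - W p $ i) * (\<bar>y $ i\<bar> - \<bar>p $ i\<bar>)) - lam * lip_W * (\<bar>y $ i\<bar> - \<bar>p $ i\<bar>)\<^sup>2
        \<le> lam * \<bar>y $ i\<bar> - lam * inverse \<rho> * psi_star a (\<rho> * \<bar>y $ i\<bar>)
        - (lam * \<bar>p $ i\<bar> - lam * inverse \<rho> * psi_star a (\<rho> * \<bar>p $ i\<bar>))"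
      by (simp add: algebra_simps)
  qed
  then have "F y - F p + lam * ((1 - W p) \<bullet> (\<bar>y\<bar> - \<bar>p\<bar>)) - lam * lip_W * (norm (\<bar>y\<bar> - \<bar>p\<bar>))\<^sup>2
      \<le> theta y - theta p"
    by (simp add: theta_def norm_1_def inner_vec_def abs_vec_nth sum_distrib_left sum_subtractf
        norm_power2_vec)
  moreover have "lam * lip_W * (norm (\<bar>y\<bar> - \<bar>p\<bar>))\<^sup>2 \<le> lam * lip_W * (norm (y - p))\<^sup>2"
    using lam lip_W_nonneg by (intro mult_left_mono power_mono norm_abs_vec_diff) auto
  ultimately show ?thesis by linarith
qed

lemma theta_nonneg: "0 \<le> theta x"
proof -
  have "inverse \<rho> * psi_star a (\<rho> * \<bar>x $ i\<bar>) \<le> \<bar>x $ i\<bar>" for i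
  proof -
    have "inverse \<rho> * psi_star a (\<rho> * \<bar>x $ i\<bar>) \<le> inverse \<rho> * (\<rho> * \<bar>x $ i\<bar>)"
      using \<rho> by (intro mult_left_mono psi_star_le_self a) auto
    also have "\<dots> = \<bar>x $ i\<bar>" using \<rho> by simp
    finally show ?thesis .
  qed
  then have "lam * (\<Sum>i\<in>UNIV. inverse \<rho> * psi_star a (\<rho> * \<bar>x $ i\<bar>)) \<le> lam * (\<Sum>i\<in>UNIV. \<bar>x $ i\<bar>)"
    using lam by (intro mult_left_mono sum_mono) auto
  moreover have "0 \<le> F x" using f_nonneg \<mu> by (simp add: F_reg_def)
  ultimately show ?thesis by (simp add: theta_def norm_1_def sum_distrib_left mult.assoc)
qed

text \<open>
  The quadratic terms of two models differ by affine functions only, so the increments of the models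
  differ by terms that are linear in the displacement of the centre or in the change of the weights.
\<close>

lemma model_change_centre:
  "model q y - model q p = model z y - model z p + lam * ((W z - W q) \<bullet> (\<bar>y\<bar> - \<bar>p\<bar>))
    + g1 * ((z - q) \<bullet> (y - p)) + g2 * ((A *v (z - q)) \<bullet> (A *v (y - p)))"
proof -
  have *: "(norm (y - q))\<^sup>2 - (norm (p - q))\<^sup>2
      = (norm (y - z))\<^sup>2 - (norm (p - z))\<^sup>2 + 2 * ((z - q) \<bullet> (y - p))" for y p z q :: "'v::real_inner"
    by (simp add: power2_norm_eq_inner inner_diff_left inner_diff_right inner_commute)
  have "g1 / 2 * ((norm (y - q))\<^sup>2 - (norm (p - q))\<^sup>2)
      = g1 / 2 * ((norm (y - z))\<^sup>2 - (norm (p - z))\<^sup>2) + g1 * ((z - q) \<bullet> (y - p))"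
    unfolding *[of y q p z] by (simp add: algebra_simps)
  moreover have "g2 / 2 * ((norm (A *v y - A *v q))\<^sup>2 - (norm (A *v p - A *v q))\<^sup>2)
      = g2 / 2 * ((norm (A *v y - A *v z))\<^sup>2 - (norm (A *v p - A *v z))\<^sup>2)
        + g2 * ((A *v (z - q)) \<bullet> (A *v (y - p)))"
    unfolding *[of "A *v y" "A *v q" "A *v p" "A *v z"]
    by (simp add: algebra_simps matrix_vector_mult_diff_distrib)
  ultimately show ?thesis
    by (simp add: MM_model_def inner_diff_left inner_diff_right algebra_simps)
qed

lemma model_change_centre_bound:
  "model z y - model z p - lip_model * norm (z - q) * norm (y - p) \<le> model q y - model q p"
proof -
  have "g1 * \<bar>(z - q) \<bullet> (y - p)\<bar> \<le> g1 * (norm (z - q) * norm (y - p))"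
    using g1 by (intro mult_left_mono Cauchy_Schwarz_ineq2) auto
  moreover have "g2 * \<bar>(A *v (z - q)) \<bullet> (A *v (y - p))\<bar> \<le> g2 * (op_A\<^sup>2 * (norm (z - q) * norm (y - p)))"
    using g2 by (intro mult_left_mono inner_A) auto
  moreover have "lam * \<bar>(W z - W q) \<bullet> (\<bar>y\<bar> - \<bar>p\<bar>)\<bar> \<le> lam * (lip_W * (norm (z - q) * norm (y - p)))"
    using lam by (intro mult_left_mono inner_W_diff) auto
  moreover have "lip_model * norm (z - q) * norm (y - p) = lam * (lip_W * (norm (z - q) * norm (y - p)))
      + g1 * (norm (z - q) * norm (y - p)) + g2 * (op_A\<^sup>2 * (norm (z - q) * norm (y - p)))"
    by (simp add: lip_model_def algebra_simps)
  moreover have "- (c * \<bar>r\<bar>) \<le> c * r" if "c > 0" for c r :: real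
    using that mult_left_mono[of "- \<bar>r\<bar>" r c] by simp
  note this[OF lam, of "(W z - W q) \<bullet> (\<bar>y\<bar> - \<bar>p\<bar>)"] this[OF g1, of "(z - q) \<bullet> (y - p)"]
    this[OF g2, of "(A *v (z - q)) \<bullet> (A *v (y - p))"]
  ultimately show ?thesis unfolding model_change_centre[of q y p z] by linarith
qed

lemma theta_model_decrease:
  "g1 / 2 * (norm (y - z))\<^sup>2 + theta y - theta z \<le> model z y - model z z"
proof -
  have "0 \<le> g2 / 2 * (norm (A *v y - A *v z))\<^sup>2" using g2 by simp
  with theta_upper[of y z] show ?thesis
    by (simp add: MM_model_def inner_diff_right algebra_simps)
qed

lemma model_at_centre_upper:
  "model p y - model p p \<le> F y - F p + lam * ((1 - W p) \<bullet> (\<bar>y\<bar> - \<bar>p\<bar>)) + lip_model * (norm (y - p))\<^sup>2"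
proof -
  have "(norm (A *v y - A *v p))\<^sup>2 \<le> op_A\<^sup>2 * (norm (y - p))\<^sup>2"
    using A_power2[of "y - p"] by (simp add: matrix_vector_mult_diff_distrib)
  then have "g2 / 2 * (norm (A *v y - A *v p))\<^sup>2 \<le> g2 / 2 * (op_A\<^sup>2 * (norm (y - p))\<^sup>2)"
    using g2 by (intro mult_left_mono) auto
  moreover have "0 \<le> lam * lip_W * (norm (y - p))\<^sup>2" "0 \<le> g1 / 2 * (norm (y - p))\<^sup>2"
    "0 \<le> g2 / 2 * (op_A\<^sup>2 * (norm (y - p))\<^sup>2)"
    using lam lip_W_nonneg g1 g2 by simp_all
  ultimately show ?thesis
    by (simp add: MM_model_def lip_model_def inner_diff_right algebra_simps)
qed

text \<open>
  A minimizer \<open>p\<close> of the model centred at \<open>z\<close> is nearly stationary for the surrogate, with an error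
  proportional to \<open>\<parallel>z - p\<parallel>\<close>.
\<close>
lemma theta_slope:
  assumes "\<And>y. y \<in> \<Omega> \<Longrightarrow> model z p \<le> model z y"
  shows "slope_at_most \<Omega> theta p (lip_model * norm (p - z))"
proof -
  have "theta p - lip_model * norm (p - z) * norm (y - p) - (lip_model + lam * lip_W) * (norm (y - p))\<^sup>2 \<le> theta y"
    if "y \<in> \<Omega>" for y
    using assms[OF that] model_change_centre_bound[of z y p p] model_at_centre_upper[of p y]
      theta_lower[of y p] by (simp add: norm_minus_commute algebra_simps)
  then show ?thesis unfolding slope_at_most_def by blast
qed

lemma linear_nth: "linear (\<lambda>x :: real ^ 'p. x $ i)"
  by (rule bounded_linear.linear[OF bounded_linear_vec_nth])

lemma piecewise_quadratic_F: "piecewise_quadratic_on UNIV F"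
proof -
  have "piecewise_quadratic_on UNIV (\<lambda>x. f (A *v x + (- b)) + \<mu> / 2 * (norm x)\<^sup>2)"
    by (intro piecewise_quadratic_on_add piecewise_quadratic_on_scale
        piecewise_quadratic_on_affine_compose[where v = "- b"]
        piecewise_linear_quadratic_imp_piecewise_quadratic_on f_plq matrix_vector_mul_linear
        piecewise_quadratic_on_global quadratic_on_norm_power2)
  then show ?thesis by (simp add: F_reg_def[abs_def])
qed

lemma piecewise_quadratic_abs_nth: "piecewise_quadratic_on UNIV (\<lambda>x :: real ^ 'p. \<bar>x $ i\<bar>)"
  using piecewise_quadratic_on_affine_compose[OF piecewise_quadratic_abs linear_nth[of i], where v = 0]
  by simp

lemma piecewise_quadratic_theta: "piecewise_quadratic_on \<Omega> theta"
proof -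
  have "piecewise_quadratic_on UNIV (\<lambda>x :: real ^ 'p. psi_star a (\<rho> * \<bar>x $ i\<bar>))" for i
  proof -
    have lin: "linear (\<lambda>x :: real ^ 'p. \<sigma> * x $ i)" for \<sigma> :: real
      using linear_compose_scale_right[OF linear_nth, of \<sigma>] by simp
    have "piecewise_quadratic_on UNIV (\<lambda>x :: real ^ 'p. psi_star a (\<sigma> * x $ i))" for \<sigma>
      using piecewise_quadratic_on_affine_compose[OF piecewise_quadratic_psi_star[OF a] lin[of \<sigma>],
          where v = 0]
      by simp
    from piecewise_quadratic_on_add[OF this[of \<rho>] this[of "- \<rho>"]]
    have "piecewise_quadratic_on UNIV (\<lambda>x :: real ^ 'p. psi_star a (\<rho> * x $ i) + psi_star a (- \<rho> * x $ i))" .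
    moreover have "psi_star a (\<rho> * t) + psi_star a (- \<rho> * t) = psi_star a (\<rho> * \<bar>t\<bar>)" for t
      using psi_star_nonpos[OF a, of "\<rho> * t"] psi_star_nonpos[OF a, of "- (\<rho> * t)"] \<rho>
      by (cases "t \<ge> 0") (auto simp: abs_if mult_le_0_iff)
    ultimately show ?thesis by simp
  qed
  then have "piecewise_quadratic_on UNIV
      (\<lambda>x. F x + lam * (\<Sum>i\<in>UNIV. \<bar>x $ i\<bar>)
         + (- (lam * inverse \<rho>)) * (\<Sum>i\<in>UNIV. psi_star a (\<rho> * \<bar>x $ i\<bar>)))"
    by (intro piecewise_quadratic_on_add piecewise_quadratic_on_scale piecewise_quadratic_on_sum
        piecewise_quadratic_F piecewise_quadratic_abs_nth) simp_all
  then have "piecewise_quadratic_on UNIV theta"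
    by (simp add: theta_def[abs_def] norm_1_def)
  then show ?thesis by (rule piecewise_quadratic_on_polyhedron[OF _ \<Omega>_polyhedron])
qed

lemma piecewise_quadratic_model: "piecewise_quadratic_on \<Omega> (model z)"
proof -
  have sq: "piecewise_quadratic_on UNIV (\<lambda>x::'v::euclidean_space. (norm x)\<^sup>2)"
    by (intro piecewise_quadratic_on_global quadratic_on_norm_power2)
  have "piecewise_quadratic_on UNIV
      (\<lambda>x. F x + lam * (\<Sum>i\<in>UNIV. (1 - W z) $ i * \<bar>x $ i\<bar>)
         + g1 / 2 * (norm (x + (- z)))\<^sup>2 + g2 / 2 * (norm (A *v x + - (A *v z)))\<^sup>2)"
    by (intro piecewise_quadratic_on_add piecewise_quadratic_on_scale piecewise_quadratic_on_sum
        piecewise_quadratic_F piecewise_quadratic_abs_nth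
        piecewise_quadratic_on_affine_compose[OF sq, of "\<lambda>x. x" "- z"]
        piecewise_quadratic_on_affine_compose[OF sq, of "(*v) A"] linear_ident
        matrix_vector_mul_linear) simp
  then have "piecewise_quadratic_on UNIV (model z)"
    by (simp add: MM_model_def[abs_def] inner_vec_def abs_vec_nth)
  then show ?thesis by (rule piecewise_quadratic_on_polyhedron[OF _ \<Omega>_polyhedron])
qed

lemma model_strongly_convex: "convex_on UNIV (\<lambda>y. model z y - \<mu> / 2 * (norm y)\<^sup>2)"
proof -
  have "convex_on UNIV (\<lambda>y. f (A *v y - b))"
  proof (rule convex_onI)
    fix t :: real and x y
    assume "0 < t" "t < 1"
    moreover have "A *v ((1 - t) *\<^sub>R x + t *\<^sub>R y) - b = (1 - t) *\<^sub>R (A *v x - b) + t *\<^sub>R (A *v y - b)"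
      by (simp add: matrix_vector_right_distrib matrix_vector_mult_scaleR algebra_simps)
    ultimately show "f (A *v ((1 - t) *\<^sub>R x + t *\<^sub>R y) - b) \<le> (1 - t) * f (A *v x - b) + t * f (A *v y - b)"
      using convex_onD[OF f_convex, of t "A *v x - b" "A *v y - b"] by simp
  qed simp
  moreover have "convex_on UNIV (\<lambda>y :: real ^ 'p. lam * ((1 - W z) \<bullet> \<bar>y\<bar>))"
  proof (rule convex_onI)
    fix t :: real and x y :: "real ^ 'p"
    assume t: "0 < t" "t < 1"
    have "(\<Sum>i\<in>UNIV. (1 - W z) $ i * \<bar>(1 - t) * x $ i + t * y $ i\<bar>)
        \<le> (\<Sum>i\<in>UNIV. (1 - W z) $ i * ((1 - t) * \<bar>x $ i\<bar> + t * \<bar>y $ i\<bar>))"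
    proof (intro sum_mono mult_left_mono)
      fix i
      show "\<bar>(1 - t) * x $ i + t * y $ i\<bar> \<le> (1 - t) * \<bar>x $ i\<bar> + t * \<bar>y $ i\<bar>"
        using abs_triangle_ineq[of "(1 - t) * x $ i" "t * y $ i"] t by (simp add: abs_mult)
    qed (simp add: W_nth weight_bounds)
    then have "(1 - W z) \<bullet> \<bar>(1 - t) *\<^sub>R x + t *\<^sub>R y\<bar> \<le> (1 - t) * ((1 - W z) \<bullet> \<bar>x\<bar>) + t * ((1 - W z) \<bullet> \<bar>y\<bar>)"
      by (simp add: inner_vec_def abs_vec_nth sum_distrib_left sum.distrib[symmetric] algebra_simps)
    from mult_left_mono[OF this, of lam] lam
    show "lam * ((1 - W z) \<bullet> \<bar>(1 - t) *\<^sub>R x + t *\<^sub>R y\<bar>)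
        \<le> (1 - t) * (lam * ((1 - W z) \<bullet> \<bar>x\<bar>)) + t * (lam * ((1 - W z) \<bullet> \<bar>y\<bar>))"
      by (simp add: algebra_simps)
  qed simp
  moreover have "convex_on UNIV (\<lambda>y. g1 / 2 * (norm (y - z))\<^sup>2)"
    using convex_on_norm_affine_power2[of "\<lambda>y. y" z] g1 by (intro convex_on_cmul) (auto simp: linear_ident)
  moreover have "convex_on UNIV (\<lambda>y. g2 / 2 * (norm (A *v y - A *v z))\<^sup>2)"
    using convex_on_norm_affine_power2[of "(*v) A"] g2 by (intro convex_on_cmul) auto
  ultimately have "convex_on UNIV (\<lambda>y. f (A *v y - b) + lam * ((1 - W z) \<bullet> \<bar>y\<bar>)
      + g1 / 2 * (norm (y - z))\<^sup>2 + g2 / 2 * (norm (A *v y - A *v z))\<^sup>2)"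
    by (intro convex_on_add)
  then show ?thesis by (simp add: MM_model_def F_reg_def algebra_simps)
qed

lemma convex_\<Omega>: "convex \<Omega>"
  by (rule polyhedron_imp_convex[OF \<Omega>_polyhedron])

lemma model_growth:
  assumes "p \<in> \<Omega>" "\<And>y. y \<in> \<Omega> \<Longrightarrow> model z p \<le> model z y" "y \<in> \<Omega>"
  shows "model z p + \<mu> / 2 * (norm (y - p))\<^sup>2 \<le> model z y"
proof -
  have "convex_on \<Omega> (\<lambda>y. model z y - \<mu> / 2 * (norm y)\<^sup>2)"
    by (rule convex_on_subset[OF model_strongly_convex subset_UNIV convex_\<Omega>])
  from minimizer_quadratic_growth[OF this assms] show ?thesis .
qed

lemma tendsto_of_Lipschitz:
  fixes G :: "real ^ 'p \<Rightarrow> real ^ 'p"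
  assumes "\<And>x. norm (G x - G p) \<le> C * norm (x - p)" "y \<longlonglongrightarrow> p"
  shows "(\<lambda>k. G (y k)) \<longlonglongrightarrow> G p"
proof -
  have "(\<lambda>k. C * norm (y k - p)) \<longlonglongrightarrow> C * norm (p - p)" by (intro tendsto_intros assms(2))
  then have "(\<lambda>k. C * norm (y k - p)) \<longlonglongrightarrow> 0" by simp
  then have "(\<lambda>k. G (y k) - G p) \<longlonglongrightarrow> 0"
    by (rule Lim_null_comparison[rotated]) (simp add: assms(1))
  then show ?thesis by (rule LIM_zero_cancel)
qed

lemma tendsto_model:
  assumes z: "z \<longlonglongrightarrow> q" and y: "y \<longlonglongrightarrow> p"
  shows "(\<lambda>k. model (z k) (y k)) \<longlonglongrightarrow> model q p"
proof -
  have "continuous_on UNIV f" by (rule convex_on_continuous[OF open_UNIV f_convex])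
  then have f: "isCont f (A *v p - b)" by (simp add: continuous_on_eq_continuous_at)
  have A: "(\<lambda>k. A *v u k) \<longlonglongrightarrow> A *v v" if "u \<longlonglongrightarrow> v" for u v
    by (rule bounded_linear.tendsto[OF matrix_vector_mul_bounded_linear that])
  have "(\<lambda>k. f (A *v y k - b)) \<longlonglongrightarrow> f (A *v p - b)"
    by (intro isCont_tendsto_compose[OF f] tendsto_intros A y)
  moreover have "(\<lambda>k. W (z k)) \<longlonglongrightarrow> W q" by (rule tendsto_of_Lipschitz[OF norm_W_diff z])
  moreover have "(\<lambda>k. \<bar>y k\<bar>) \<longlonglongrightarrow> \<bar>p\<bar>"
    using norm_abs_vec_diff by (intro tendsto_of_Lipschitz[OF _ y, of _ 1]) simp
  ultimately show ?thesis
    unfolding MM_model_def F_reg_def by (intro tendsto_intros A y z)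
qed

end

section \<open>Subdifferentials\<close>

text \<open>A quadratic minorant touching \<open>h\<close> at \<open>x\<close> makes the difference quotients nonnegative in the limit.\<close>

lemma zero_in_regular_subdifferential:
  fixes h :: "'a::real_inner \<Rightarrow> ereal"
  assumes hx: "h x = ereal r" and \<delta>: "\<delta> > 0"
    and lower: "\<And>y. norm (y - x) < \<delta> \<Longrightarrow> ereal (r - C * (norm (y - x))\<^sup>2) \<le> h y"
  shows "0 \<in> regular_subdifferential h x"
proof -
  have bound: "ereal (- C * norm (y - x)) \<le> (h y - h x - ereal (0 \<bullet> (y - x))) / ereal (norm (y - x))"
    if y: "y \<noteq> x" "norm (y - x) < \<delta>" for y
  proof (cases "h y")
    case (real s)
    have "(r - C * (norm (y - x))\<^sup>2 - r) / norm (y - x) \<le> (s - r) / norm (y - x)"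
      using lower[OF y(2)] real by (intro divide_right_mono) auto
    then show ?thesis using y(1) by (simp add: hx real power2_eq_square)
  next
    case PInf
    then show ?thesis using y(1) by (simp add: hx)
  next
    case MInf
    then show ?thesis using lower[OF y(2)] by simp
  qed
  have "\<forall>\<^sub>F y in at x. dist y x < \<delta> \<and> y \<noteq> x"
    using \<delta> by (auto simp: eventually_at)
  then have "\<forall>\<^sub>F y in at x. ereal (- C * norm (y - x))
      \<le> (h y - h x - ereal (0 \<bullet> (y - x))) / ereal (norm (y - x))"
    by (rule eventually_mono) (rule bound, auto simp: dist_norm)
  then have "Liminf (at x) (\<lambda>y. ereal (- C * norm (y - x)))
      \<le> Liminf (at x) (\<lambda>y. (h y - h x - ereal (0 \<bullet> (y - x))) / ereal (norm (y - x)))"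
    by (rule Liminf_mono)
  moreover have "0 \<le> Liminf (at x) (\<lambda>y. ereal (- C * norm (y - x)))"
  proof (cases "at x = bot")
    case False
    have "((\<lambda>y. - C * norm (y - x)) \<longlongrightarrow> - C * norm (x - x)) (at x)" by (intro tendsto_intros)
    then have "((\<lambda>y. ereal (- C * norm (y - x))) \<longlongrightarrow> ereal 0) (at x)" by simp
    from lim_imp_Liminf[OF False this] show ?thesis by simp
  qed simp
  ultimately show ?thesis by (simp add: regular_subdifferential_def hx)
qed

lemma regular_subdifferential_subset_limiting:
  "regular_subdifferential h x \<subseteq> limiting_subdifferential h x"
proof
  fix v assume v: "v \<in> regular_subdifferential h x"
  then have "\<bar>h x\<bar> \<noteq> \<infinity>" by (simp add: regular_subdifferential_def)
  moreover have "\<exists>y u. y \<longlonglongrightarrow> x \<and> (\<lambda>k. h (y k)) \<longlonglongrightarrow> h x \<and> u \<longlonglongrightarrow> v \<and>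
      (\<forall>k::nat. u k \<in> regular_subdifferential h (y k))"
    by (rule exI[of _ "\<lambda>_. x"], rule exI[of _ "\<lambda>_. v"]) (simp add: v)
  ultimately show "v \<in> limiting_subdifferential h x" unfolding limiting_subdifferential_def by blast
qed

section \<open>Convergence of the proximal MM iteration\<close>

lemma geometric_steps_limit:
  fixes x :: "nat \<Rightarrow> 'a::banach"
  assumes q: "0 < q" "q < 1" and step: "\<And>k. norm (x (Suc k) - x k) \<le> K * q ^ k"
  shows "\<exists>p. x \<longlonglongrightarrow> p \<and> (\<forall>k. norm (x k - p) \<le> K / (1 - q) * q ^ k)"
proof -
  have K: "K \<ge> 0" using order_trans[OF norm_ge_zero step[of 0]] by simp
  have "summable (\<lambda>k. x (Suc k) - x k)"
    using q by (intro summable_comparison_test'[OF _ step] summable_mult summable_geometric) auto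
  then have "(\<lambda>n. \<Sum>k<n. x (Suc k) - x k) \<longlonglongrightarrow> (\<Sum>k. x (Suc k) - x k)" by (rule summable_LIMSEQ)
  then have "(\<lambda>n. x n - x 0 + x 0) \<longlonglongrightarrow> (\<Sum>k. x (Suc k) - x k) + x 0"
    unfolding sum_lessThan_telescope by (intro tendsto_intros)
  then have lim: "x \<longlonglongrightarrow> (\<Sum>k. x (Suc k) - x k) + x 0" (is "x \<longlonglongrightarrow> ?p") by simp
  have "norm (x k - ?p) \<le> K / (1 - q) * q ^ k" for k
  proof -
    have "norm (x (k + n) - x k) \<le> K / (1 - q) * q ^ k * (1 - q ^ n)" for n
    proof (induction n)
      case (Suc n)
      have "norm (x (k + Suc n) - x k) \<le> norm (x (Suc (k + n)) - x (k + n)) + norm (x (k + n) - x k)"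
        using norm_triangle_ineq[of "x (Suc (k + n)) - x (k + n)" "x (k + n) - x k"] by simp
      also have "\<dots> \<le> K * q ^ (k + n) + K / (1 - q) * q ^ k * (1 - q ^ n)"
        by (intro add_mono step Suc.IH)
      also have "\<dots> = K / (1 - q) * q ^ k * (1 - q ^ Suc n)"
        using q by (simp add: power_add divide_simps) (simp add: algebra_simps)
      finally show ?case .
    qed simp
    also have "K / (1 - q) * q ^ k * (1 - q ^ n) \<le> K / (1 - q) * q ^ k * 1" for n
      using K q by (intro mult_left_mono) auto
    finally have "norm (x k - x (k + n)) \<le> K / (1 - q) * q ^ k" for n
      by (simp add: norm_minus_commute)
    moreover have "(\<lambda>n. norm (x k - x (k + n))) \<longlonglongrightarrow> norm (x k - ?p)"
      using LIMSEQ_ignore_initial_segment[OF lim, of k]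
      by (intro tendsto_intros) (simp add: add.commute)
    ultimately show ?thesis by (intro LIMSEQ_le_const2) auto
  qed
  with lim show ?thesis by blast
qed

locale proximal_MM = surrogate +
  fixes x :: "nat \<Rightarrow> real ^ 'b"
  assumes x_in: "\<And>k. x k \<in> \<Omega>"
    and x_min: "\<And>k y. y \<in> \<Omega> \<Longrightarrow> model (x k) (x (Suc k)) \<le> model (x k) y"
begin

lemma steps_geometric: "\<exists>K q. 0 < q \<and> q < 1 \<and> (\<forall>k. norm (x (Suc k) - x k) \<le> K * q ^ k)"
proof (rule piecewise_quadratic_descent_steps_geometric[OF piecewise_quadratic_theta])
  show "g1 / 2 * (norm (x (Suc k) - x k))\<^sup>2 \<le> theta (x k) - theta (x (Suc k))" for k
    using theta_model_decrease[of "x (Suc k)" "x k"] x_min[OF x_in, of k k] by linarith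
  show "slope_at_most \<Omega> theta (x (Suc k)) (lip_model * norm (x (Suc k) - x k))" for k
    by (rule theta_slope) (rule x_min)
qed (use g1 x_in theta_nonneg lip_model_nonneg in auto)

end

locale proximal_MM_limit = proximal_MM +
  fixes p :: "real ^ 'b" and K q :: real
  assumes q: "0 < q" "q < 1" and lim: "x \<longlonglongrightarrow> p" and R_linear: "\<And>k. norm (x k - p) \<le> K * q ^ k"
begin

lemma p_in: "p \<in> \<Omega>"
  by (rule closed_sequentially[OF polyhedron_imp_closed[OF \<Omega>_polyhedron] x_in lim])

lemma p_min: "y \<in> \<Omega> \<Longrightarrow> model p p \<le> model p y"
  by (rule LIMSEQ_le[OF tendsto_model[OF lim LIMSEQ_Suc[OF lim]] tendsto_model[OF lim tendsto_const]])
    (use x_min in auto)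

lemma regular_critical_point_Theta: "regular_critical_point (Theta f A b \<Omega> \<mu> a lam \<rho>) p"
proof -
  obtain D where D: "\<And>y. y \<in> \<Omega> \<Longrightarrow> theta p - lip_model * norm (p - p) * norm (y - p) - D * (norm (y - p))\<^sup>2 \<le> theta y"
    using theta_slope[OF p_min] unfolding slope_at_most_def by blast
  show ?thesis
    unfolding regular_critical_point_def
    by (rule zero_in_regular_subdifferential[of _ _ "theta p" 1 D])
      (use D p_in in \<open>auto simp: Theta_eq\<close>)
qed

text \<open>
  The weights are \<open>1\<close> on the support of \<open>p\<close> and \<open>0\<close> off it, so near \<open>p\<close> the linearized penalty
  \<open>\<lambda> \<langle>1 - w, |y| - |p|\<rangle>\<close> is \<open>\<lambda>\<close> times the \<open>\<ell>\<^sub>1\<close> norm of \<open>y\<close> off the support, and it is dominated by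
  the jump of the zero norm.
\<close>
lemma regular_critical_point_zero_norm:
  assumes nz: "ereal (2 * a / (\<rho> * (a + 1))) \<le> min_abs_nz p"
  shows "regular_critical_point (zero_norm_objective f A b \<Omega> \<mu> (lam / \<rho>)) p"
proof -
  have W1: "W p $ i = 1" if "p $ i \<noteq> 0" for i
  proof -
    have "min_abs_nz p \<le> ereal \<bar>p $ i\<bar>"
      unfolding min_abs_nz_def by (rule INF_lower) (use that in simp)
    with nz have "ereal (2 * a / (\<rho> * (a + 1))) \<le> ereal \<bar>p $ i\<bar>" by (rule order_trans)
    then have "2 * a / (\<rho> * (a + 1)) \<le> \<bar>p $ i\<bar>" by simp
    then have "\<rho> * (2 * a / (\<rho> * (a + 1))) \<le> \<rho> * \<bar>p $ i\<bar>" using \<rho> by (intro mult_left_mono) auto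
    then show ?thesis unfolding W_nth using \<rho> by (intro weight_eq_1 a) simp
  qed
  have W0: "W p $ i = 0" if "p $ i = 0" for i
    unfolding W_nth using a that by (intro weight_eq_0) auto
  define \<delta> where "\<delta> = Min (insert (1 / \<rho>) ((\<lambda>i. \<bar>p $ i\<bar>) ` {i. p $ i \<noteq> 0}))"
  have \<delta>: "\<delta> > 0" unfolding \<delta>_def using \<rho> by (subst Min_gr_iff) auto
  have \<delta>1: "\<delta> \<le> 1 / \<rho>" unfolding \<delta>_def by (rule Min_le) auto
  have \<delta>2: "\<delta> \<le> \<bar>p $ i\<bar>" if "p $ i \<noteq> 0" for i unfolding \<delta>_def using that by (intro Min_le) auto
  define ind where "ind y i = (if y $ i = 0 then 0 else 1 :: real)" for y :: "real ^ 'b" and i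
  have norm_0: "real (norm_0 y) = (\<Sum>i\<in>UNIV. ind y i)" for y
    by (simp add: norm_0_def ind_def sum.If_cases Collect_neg_eq)
  have penalty: "lam * ((1 - W p) \<bullet> (\<bar>y\<bar> - \<bar>p\<bar>)) \<le> lam / \<rho> * real (norm_0 y) - lam / \<rho> * real (norm_0 p)"
    if y: "norm (y - p) < \<delta>" for y
  proof -
    have "(1 - W p $ i) * (\<bar>y $ i\<bar> - \<bar>p $ i\<bar>) \<le> 1 / \<rho> * (ind y i - ind p i)" for i
    proof -
      have yi: "\<bar>y $ i - p $ i\<bar> < \<delta>" using component_le_norm_cart[of "y - p" i] y by simp
      show ?thesis
      proof (cases "p $ i = 0")
        case True
        with yi \<delta>1 have "\<bar>y $ i\<bar> \<le> 1 / \<rho>" by simp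
        then show ?thesis using True W0[OF True] \<rho> by (simp add: ind_def)
      next
        case False
        with yi \<delta>2[OF False] have "y $ i \<noteq> 0" by auto
        then show ?thesis using False W1[OF False] by (simp add: ind_def)
      qed
    qed
    then have "(\<Sum>i\<in>UNIV. (1 - W p $ i) * (\<bar>y $ i\<bar> - \<bar>p $ i\<bar>)) \<le> (\<Sum>i\<in>UNIV. 1 / \<rho> * (ind y i - ind p i))"
      by (intro sum_mono)
    also have "\<dots> = 1 / \<rho> * (real (norm_0 y) - real (norm_0 p))"
      by (simp only: norm_0 sum_distrib_left sum_subtractf right_diff_distrib)
    finally have "(1 - W p) \<bullet> (\<bar>y\<bar> - \<bar>p\<bar>) \<le> 1 / \<rho> * (real (norm_0 y) - real (norm_0 p))"
      by (simp add: inner_vec_def abs_vec_nth)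
    from mult_left_mono[OF this, of lam] lam show ?thesis by (simp add: algebra_simps)
  qed
  define g where "g y = F y + lam / \<rho> * real (norm_0 y)" for y
  have obj: "zero_norm_objective f A b \<Omega> \<mu> (lam / \<rho>) y = (if y \<in> \<Omega> then ereal (g y) else \<infinity>)" for y
    by (simp add: zero_norm_objective_def delta_def g_def F_reg_def)
  have "g p - lip_model * (norm (y - p))\<^sup>2 \<le> g y" if "y \<in> \<Omega>" "norm (y - p) < \<delta>" for y
    using p_min[OF that(1)] model_at_centre_upper[of p y] penalty[OF that(2)] unfolding g_def by linarith
  then show ?thesis
    unfolding regular_critical_point_def
    by (intro zero_in_regular_subdifferential[of _ _ "g p" \<delta> lip_model]) (use \<delta> p_in in \<open>auto simp: obj\<close>)
qed

text \<open>
  Near the limit \<open>p\<close>, the model centred at \<open>x\<^sub>k\<close> is \<open>G(y) - B(d\<^sub>k, y)\<close> up to a constant, where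
  \<open>d\<^sub>k = x\<^sub>k - p\<close>, \<open>y\<close> is measured from \<open>p\<close>, \<open>G\<close> is the model centred at \<open>p\<close>, and \<open>B\<close> collects the
  proximal terms and the locally homogeneous change of the weights. Thus the iteration is
  eventually a nonlinear power method.
\<close>
lemma Q_linear_if_never_at_limit:
  assumes nz: "\<And>k. x k \<noteq> p"
  shows "\<exists>c. 0 < c \<and> c < 1 \<and> (\<forall>\<^sub>F k in sequentially. norm (x (Suc k) - p) \<le> c * norm (x k - p))"
proof -
  have "\<forall>i. \<exists>\<epsilon> \<kappa> \<kappa>'. \<epsilon> > 0 \<and> 0 \<le> \<kappa> \<and> 0 \<le> \<kappa>' \<and> (\<forall>u v. \<bar>u\<bar> < \<epsilon> \<longrightarrow> \<bar>v\<bar> < \<epsilon> \<longrightarrow>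
      (weight a (\<rho> * \<bar>p $ i + u\<bar>) - weight a (\<rho> * \<bar>p $ i\<bar>)) * (\<bar>p $ i + v\<bar> - \<bar>p $ i\<bar>)
        = (if 0 \<le> u then \<kappa> else \<kappa>') * u * v)"
    using weight_abs_locally_bilinear[OF a \<rho>] by blast
  then obtain \<epsilon> \<kappa> \<kappa>' where loc: "\<And>i. \<epsilon> i > 0" "\<And>i. 0 \<le> \<kappa> i" "\<And>i. 0 \<le> \<kappa>' i"
    "\<And>i u v. \<bar>u\<bar> < \<epsilon> i \<Longrightarrow> \<bar>v\<bar> < \<epsilon> i \<Longrightarrow>
      (weight a (\<rho> * \<bar>p $ i + u\<bar>) - weight a (\<rho> * \<bar>p $ i\<bar>)) * (\<bar>p $ i + v\<bar> - \<bar>p $ i\<bar>)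
        = (if 0 \<le> u then \<kappa> i else \<kappa>' i) * u * v"
    by metis
  define kap where "kap i u = (if 0 \<le> u then \<kappa> i else \<kappa>' i)" for i and u :: real
  have kap: "0 \<le> kap i u" "kap i u \<le> \<kappa> i + \<kappa>' i" for i u using loc(2,3) by (auto simp: kap_def)
  define B where "B d y = g1 * (d \<bullet> y) + g2 * ((A *v d) \<bullet> (A *v y))
    + lam * (\<Sum>i\<in>UNIV. kap i (d $ i) * d $ i * y $ i)" for d y :: "real ^ 'b"
  define G where "G y = model p (p + y) - model p p" for y
  define \<epsilon>0 where "\<epsilon>0 = Min (range \<epsilon>)"
  have \<epsilon>0: "\<epsilon>0 > 0" "\<And>i. \<epsilon>0 \<le> \<epsilon> i" using loc(1) by (auto simp: \<epsilon>0_def)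
  have model_eq: "model (p + d) (p + y) - model (p + d) p = G y - B d y"
    if "norm d < \<epsilon>0" "norm y < \<epsilon>0" for d y
  proof -
    have "\<bar>d $ i\<bar> < \<epsilon> i" "\<bar>y $ i\<bar> < \<epsilon> i" for i
      using that \<epsilon>0(2)[of i] component_le_norm_cart[of d i] component_le_norm_cart[of y i] by linarith+
    then have "(W (p + d) - W p) \<bullet> (\<bar>p + y\<bar> - \<bar>p\<bar>) = (\<Sum>i\<in>UNIV. kap i (d $ i) * d $ i * y $ i)"
      using loc(4) by (simp add: inner_vec_def abs_vec_nth W_nth kap_def)
    then show ?thesis
      using model_change_centre[of p "p + y" p "p + d"] by (simp add: G_def B_def)
  qed
  define d where "d k = x k - p" for k
  have d0: "d \<longlonglongrightarrow> 0" unfolding d_def using LIM_zero[OF lim] .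
  have seg: "p + t *\<^sub>R d k \<in> \<Omega>" if "0 \<le> t" "t \<le> 1" for t k
  proof -
    have "p + t *\<^sub>R d k = (1 - t) *\<^sub>R p + t *\<^sub>R x k" by (simp add: d_def algebra_simps)
    then show ?thesis using convexD_alt[OF convex_\<Omega> p_in x_in] that by simp
  qed
  have "\<forall>\<^sub>F k in sequentially. \<forall>t\<in>{0..1}. model p (p + t *\<^sub>R (x (Suc k) - p))
      = model p p + t\<^sup>2 * (model p (x (Suc k)) - model p p)"
  proof (rule piecewise_quadratic_radially_homogeneous[OF piecewise_quadratic_model x_in LIMSEQ_Suc[OF lim]])
    show "slope_at_most \<Omega> (model p) (x (Suc k)) (lip_model * norm (x k - p))" for k
      unfolding slope_at_most_def
    proof (intro exI[of _ 0] ballI)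
      fix y assume "y \<in> \<Omega>"
      then show "model p (x (Suc k)) - lip_model * norm (x k - p) * norm (y - x (Suc k)) - 0 * (norm (y - x (Suc k)))\<^sup>2
          \<le> model p y"
        using model_change_centre_bound[of "x k" y "x (Suc k)" p] x_min[of y k] by simp
    qed
    have "(\<lambda>k. lip_model * norm (x k - p)) \<longlonglongrightarrow> lip_model * norm (p - p)" by (intro tendsto_intros lim)
    then show "(\<lambda>k. lip_model * norm (x k - p)) \<longlonglongrightarrow> 0" by simp
  qed
  moreover have "\<forall>\<^sub>F k in sequentially. norm (d k) < \<epsilon>0"
    using d0 \<epsilon>0(1) order_tendstoD(2)[OF tendsto_norm_zero[OF d0]] by blast
  ultimately have "\<forall>\<^sub>F k in sequentially. (\<forall>t\<in>{0..1}. model p (p + t *\<^sub>R (x (Suc k) - p))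
      = model p p + t\<^sup>2 * (model p (x (Suc k)) - model p p)) \<and> norm (d k) < \<epsilon>0"
    by (rule eventually_conj)
  then obtain N where N: "\<And>k t. k \<ge> N \<Longrightarrow> 0 \<le> t \<Longrightarrow> t \<le> 1 \<Longrightarrow> G (t *\<^sub>R d (Suc k)) = t\<^sup>2 * G (d (Suc k))"
    "\<And>k. k \<ge> N \<Longrightarrow> norm (d k) < \<epsilon>0"
    unfolding eventually_sequentially G_def d_def by force
  \<comment> \<open>The expansion along segments is available at minimizers of models, that is from index \<open>1\<close> on.\<close>
  define M where "M = Suc N"
  have hom: "G (t *\<^sub>R d (M + k)) = t\<^sup>2 * G (d (M + k))" if "0 \<le> t" "t \<le> 1" for k t
    using N(1)[of "N + k", OF _ that] by (simp add: M_def)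
  have small: "norm (d (M + k)) < \<epsilon>0" for k using N(2)[of "M + k"] by (simp add: M_def)
  have growth: "\<mu> / 2 * (norm y)\<^sup>2 \<le> G y" if "p + y \<in> \<Omega>" for y
    using model_growth[OF p_in p_min that] by (simp add: G_def)
  have Binner: "B e e = g1 * (norm e)\<^sup>2 + g2 * (norm (A *v e))\<^sup>2 + lam * (\<Sum>i\<in>UNIV. kap i (e $ i) * (e $ i)\<^sup>2)" for e
    by (simp add: B_def power2_norm_eq_inner) (simp add: power2_eq_square mult.assoc)
  have "\<exists>c. 0 < c \<and> c < 1 \<and> (\<forall>\<^sub>F k in sequentially. norm (d (M + Suc k)) \<le> c * norm (d (M + k)))"
  proof (rule nonlinear_power_method_Q_linear[where G = G and B = B and m = "\<mu> / 2" and q = q and K = "K * q ^ M"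
        and C = "g1 + g2 * op_A\<^sup>2 + lam * (\<Sum>i\<in>UNIV. \<kappa> i + \<kappa>' i)"])
    show "\<mu> / 2 > 0" using \<mu> by simp
    show "G (t *\<^sub>R d (M + k)) = t\<^sup>2 * G (d (M + k))" if "0 \<le> t" "t \<le> 1" for k t using hom[OF that] .
    show "B (d (M + k)) (t *\<^sub>R d (M + k)) = t * B (d (M + k)) (d (M + k))" for k t
      by (simp add: B_def matrix_vector_mult_scaleR sum_distrib_left algebra_simps)
    show "G (d (M + Suc k)) - B (d (M + k)) (d (M + Suc k)) + \<mu> / 2 * (norm (t *\<^sub>R d (M + k) - d (M + Suc k)))\<^sup>2
        \<le> G (t *\<^sub>R d (M + k)) - B (d (M + k)) (t *\<^sub>R d (M + k))" if t: "0 \<le> t" "t \<le> 1" for k t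
    proof -
      have "norm (t *\<^sub>R d (M + k)) < \<epsilon>0"
        using small[of k] mult_right_mono[OF t(2), of "norm (d (M + k))"] t(1) by simp
      note eq = model_eq[OF small[of k] this] model_eq[OF small[of k] small[of "Suc k"]]
      have "model (x (M + k)) (x (Suc (M + k))) + \<mu> / 2 * (norm (p + t *\<^sub>R d (M + k) - x (Suc (M + k))))\<^sup>2
          \<le> model (x (M + k)) (p + t *\<^sub>R d (M + k))"
        by (rule model_growth[OF x_in x_min seg[OF t]])
      moreover have xk: "x j = p + d j" for j by (simp add: d_def)
      ultimately have "model (p + d (M + k)) (p + d (M + Suc k))
          + \<mu> / 2 * (norm (t *\<^sub>R d (M + k) - d (M + Suc k)))\<^sup>2
          \<le> model (p + d (M + k)) (p + t *\<^sub>R d (M + k))"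
        unfolding xk by simp
      with eq show ?thesis by linarith
    qed
    show "2 * \<sigma> * B (d (M + k)) (d (M + Suc k))
        \<le> \<sigma>\<^sup>2 * B (d (M + k)) (d (M + k)) + B (d (M + Suc k)) (d (M + Suc k))" if \<sigma>: "\<sigma> \<ge> 0" for k \<sigma>
    proof -
      have cs: "2 * \<sigma> * (u \<bullet> v) \<le> \<sigma>\<^sup>2 * (norm u)\<^sup>2 + (norm v)\<^sup>2" for u v :: "'v::real_inner"
      proof -
        have "(norm (\<sigma> *\<^sub>R u - v))\<^sup>2 = \<sigma>\<^sup>2 * (norm u)\<^sup>2 + (norm v)\<^sup>2 - 2 * \<sigma> * (u \<bullet> v)"
          by (simp only: power2_norm_eq_inner inner_diff_left inner_diff_right inner_scaleR_left
              inner_scaleR_right inner_commute[of v u]) (simp add: power2_eq_square algebra_simps)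
        then show ?thesis using zero_le_power2[of "norm (\<sigma> *\<^sub>R u - v)"] by linarith
      qed
      have scalar: "2 * \<sigma> * (kap i u * u * v) \<le> \<sigma>\<^sup>2 * (kap i u * u\<^sup>2) + kap i v * v\<^sup>2" for i and u v :: real
      proof (cases "u * v \<le> 0")
        case True
        then have "(2 * \<sigma> * kap i u) * (u * v) \<le> 0"
          by (rule mult_nonneg_nonpos[rotated]) (use \<sigma> kap(1)[of i u] in simp)
        moreover have "0 \<le> \<sigma>\<^sup>2 * (kap i u * u\<^sup>2) + kap i v * v\<^sup>2" using kap(1) by simp
        moreover have "2 * \<sigma> * (kap i u * u * v) = (2 * \<sigma> * kap i u) * (u * v)" by (simp add: mult.assoc)
        ultimately show ?thesis by linarith
      next
        case False
        then have "kap i v = kap i u" by (auto simp: kap_def mult_le_0_iff)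
        moreover have "0 \<le> kap i u * (\<sigma> * u - v)\<^sup>2" using kap(1) by simp
        ultimately show ?thesis by (simp add: power2_eq_square algebra_simps)
      qed
      define u v where "u = d (M + k)" and "v = d (M + Suc k)"
      have "(\<Sum>i\<in>UNIV. 2 * \<sigma> * (kap i (u $ i) * u $ i * v $ i))
          \<le> (\<Sum>i\<in>UNIV. \<sigma>\<^sup>2 * (kap i (u $ i) * (u $ i)\<^sup>2) + kap i (v $ i) * (v $ i)\<^sup>2)"
        by (intro sum_mono scalar)
      then have S: "2 * \<sigma> * (\<Sum>i\<in>UNIV. kap i (u $ i) * u $ i * v $ i)
          \<le> \<sigma>\<^sup>2 * (\<Sum>i\<in>UNIV. kap i (u $ i) * (u $ i)\<^sup>2) + (\<Sum>i\<in>UNIV. kap i (v $ i) * (v $ i)\<^sup>2)"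
        by (simp only: sum.distrib sum_distrib_left[symmetric])
      have "2 * \<sigma> * B u v \<le> \<sigma>\<^sup>2 * B u u + B v v"
        using mult_left_mono[OF S, of lam] mult_left_mono[OF cs[of u v], of g1]
          mult_left_mono[OF cs[of "A *v u" "A *v v"], of g2] lam g1 g2
        unfolding Binner by (simp add: B_def algebra_simps)
      then show ?thesis by (simp add: u_def v_def)
    qed
    show "0 < B (d (M + k)) (d (M + k))" for k
    proof -
      have "0 < g1 * (norm (d (M + k)))\<^sup>2" using nz[of "M + k"] g1 by (simp add: d_def)
      moreover have "0 \<le> g2 * (norm (A *v d (M + k)))\<^sup>2" using g2 by simp
      moreover have "0 \<le> lam * (\<Sum>i\<in>UNIV. kap i (d (M + k) $ i) * (d (M + k) $ i)\<^sup>2)"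
        using lam kap(1) by (intro mult_nonneg_nonneg sum_nonneg) auto
      ultimately show ?thesis unfolding Binner by linarith
    qed
    show "B (d (M + k)) (d (M + k)) \<le> (g1 + g2 * op_A\<^sup>2 + lam * (\<Sum>i\<in>UNIV. \<kappa> i + \<kappa>' i)) * (norm (d (M + k)))\<^sup>2" for k
    proof -
      define e where "e = d (M + k)"
      have "(\<Sum>i\<in>UNIV. kap i (e $ i) * (e $ i)\<^sup>2) \<le> (\<Sum>i\<in>UNIV. (\<kappa> i + \<kappa>' i) * (norm e)\<^sup>2)"
      proof (intro sum_mono mult_mono kap)
        show "(e $ i)\<^sup>2 \<le> (norm e)\<^sup>2" for i
          using power_mono[OF component_le_norm_cart[of e i], of 2] by simp
      qed (use loc(2,3) in auto)
      also have "\<dots> = (\<Sum>i\<in>UNIV. \<kappa> i + \<kappa>' i) * (norm e)\<^sup>2" by (simp only: sum_distrib_right)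
      finally have "lam * (\<Sum>i\<in>UNIV. kap i (e $ i) * (e $ i)\<^sup>2) \<le> lam * ((\<Sum>i\<in>UNIV. \<kappa> i + \<kappa>' i) * (norm e)\<^sup>2)"
        using lam by (intro mult_left_mono) auto
      moreover have "g2 * (norm (A *v e))\<^sup>2 \<le> g2 * (op_A\<^sup>2 * (norm e)\<^sup>2)"
        using g2 by (intro mult_left_mono A_power2) auto
      ultimately have "B e e \<le> (g1 + g2 * op_A\<^sup>2 + lam * (\<Sum>i\<in>UNIV. \<kappa> i + \<kappa>' i)) * (norm e)\<^sup>2"
        unfolding Binner distrib_right[of _ _ "(norm e)\<^sup>2"] mult.assoc by linarith
      then show ?thesis by (simp add: e_def)
    qed
    show "0 < G (d (M + k))" for k
    proof -
      have "0 < \<mu> / 2 * (norm (d (M + k)))\<^sup>2" using nz[of "M + k"] \<mu> by (simp add: d_def)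
      also have "\<dots> \<le> G (d (M + k))" using x_in by (intro growth) (simp add: d_def)
      finally show ?thesis .
    qed
    have "(\<lambda>k. model p (x k) - model p p) \<longlonglongrightarrow> model p p - model p p"
      by (intro tendsto_intros tendsto_model[OF tendsto_const lim])
    then have "(\<lambda>k. G (d k)) \<longlonglongrightarrow> 0" by (simp add: G_def d_def)
    from LIMSEQ_ignore_initial_segment[OF this, of M] show "(\<lambda>k. G (d (M + k))) \<longlonglongrightarrow> 0"
      by (simp add: add.commute)
    show "norm (d (M + k)) \<le> K * q ^ M * q ^ k" for k
      using R_linear[of "M + k"] by (simp add: d_def power_add mult.assoc)
  qed (use q nz in \<open>simp_all add: d_def\<close>)
  then obtain c where c: "0 < c" "c < 1"
    and ev: "\<forall>\<^sub>F k in sequentially. norm (x (Suc (k + M)) - p) \<le> c * norm (x (k + M) - p)"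
    by (auto simp: d_def add.commute)
  from ev have "\<forall>\<^sub>F k in sequentially. norm (x (Suc k) - p) \<le> c * norm (x k - p)"
    by (rule eventually_sequentially_seg[THEN iffD1])
  with c show ?thesis by blast
qed

lemma Q_linearly_converges: "Q_linearly_converges x p"
proof (cases "\<exists>k. x k = p")
  case True
  then obtain N where N: "x N = p" by blast
  have fixed: "x (Suc k) = p" if "x k = p" for k
  proof -
    have "\<mu> / 2 * (norm (x (Suc k) - p))\<^sup>2 \<le> 0"
      using model_growth[OF p_in p_min x_in[of "Suc k"]] x_min[OF p_in, of k] that by simp
    with \<mu> show ?thesis by (simp add: mult_le_0_iff)
  qed
  have "x k = p" if "k \<ge> N" for k using that by (induction rule: dec_induct) (use N fixed in auto)
  then have "\<forall>\<^sub>F k in sequentially. norm (x (Suc k) - p) \<le> 1/2 * norm (x k - p)"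
    unfolding eventually_sequentially by (intro exI[of _ N]) auto
  with lim show ?thesis unfolding Q_linearly_converges_def by (intro conjI exI[of _ "1/2"]) auto
next
  case False
  with Q_linear_if_never_at_limit lim show ?thesis unfolding Q_linearly_converges_def by blast
qed

end

text \<open>
  From the second term on the sequence is nonincreasing and at least \<open>\<gamma>\<close>. If it never reaches \<open>\<gamma>\<close>,
  it is multiplied by \<open>v\<close> in every step, which for \<open>v < 1\<close> drives it below \<open>\<gamma>\<close>.
\<close>
lemma proximal_parameter_eventually_constant:
  fixes g :: "nat \<Rightarrow> real"
  assumes rec: "\<And>k. g (Suc k) = max \<gamma> (v * g k)" and \<gamma>: "\<gamma> > 0" and v: "0 < v" "v \<le> 1"
  shows "\<exists>N. \<forall>k\<ge>N. g k = g N"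
proof (cases "\<exists>k. g (Suc k) = \<gamma>")
  case True
  then obtain N where N: "g (Suc N) = \<gamma>" by blast
  have "g k = \<gamma>" if "k \<ge> Suc N" for k
    using that
  proof (induction rule: dec_induct)
    case (step k)
    have "v * \<gamma> \<le> 1 * \<gamma>" using v \<gamma> by (intro mult_right_mono) auto
    then show ?case using step.IH by (simp add: rec)
  qed (rule N)
  then show ?thesis by (intro exI[of _ "Suc N"]) (simp add: N)
next
  case False
  then have mult: "g (Suc k) = v * g k" for k using rec[of k] by (metis max_def)
  have ge: "g (Suc k) \<ge> \<gamma>" for k by (simp add: rec)
  have pow: "g k = v ^ k * g 0" for k by (induction k) (simp_all add: mult)
  have "v = 1"
  proof (rule ccontr)
    assume "v \<noteq> 1"
    then have "(\<lambda>k. v ^ Suc k * g 0) \<longlonglongrightarrow> 0 * g 0"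
      using v by (intro tendsto_intros LIMSEQ_Suc LIMSEQ_power_zero) auto
    moreover have "\<gamma> \<le> v ^ Suc k * g 0" for k using ge[of k] pow[of "Suc k"] by simp
    ultimately have "\<gamma> \<le> 0 * g 0" by (intro LIMSEQ_le_const) auto
    with \<gamma> show False by simp
  qed
  then show ?thesis using pow by (intro exI[of _ 0]) simp
qed

theorem theorem4p1:
  fixes f :: "real ^ 'n \<Rightarrow> real" and A :: "real ^ 'p ^ 'n" and b :: "real ^ 'n"
    and \<Omega> :: "(real ^ 'p) set" and \<mu> a lam \<rho> \<gamma>1_low \<gamma>2_low varrho :: real
    and \<gamma>\<^sub>1 \<gamma>\<^sub>2 :: "nat \<Rightarrow> real" and x :: "nat \<Rightarrow> real ^ 'p"
  assumes "piecewise_linear_quadratic f" and "convex_on UNIV f" and "\<And>y. f y \<ge> 0"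
    and "polyhedron \<Omega>" and "\<Omega> \<noteq> {}"
    and "\<mu> > 0" and "a > 1" and "lam > 0" and "\<rho> \<ge> 1"
    and "\<gamma>\<^sub>1 0 > 0" and "\<gamma>\<^sub>2 0 > 0" and "\<gamma>1_low > 0" and "\<gamma>2_low > 0"
    and "0 < varrho" and "varrho \<le> 1"
    and "proximal_MM_sequence f A b \<Omega> \<mu> a lam \<rho> \<gamma>1_low \<gamma>2_low varrho \<gamma>\<^sub>1 \<gamma>\<^sub>2 x"
  shows "summable (\<lambda>k. norm (x (Suc (Suc k)) - x (Suc k)))
    \<and> (\<exists>xbar. x \<longlonglongrightarrow> xbar
          \<and> critical_point (Theta f A b \<Omega> \<mu> a lam \<rho>) xbar
          \<and> (ereal (2 * a / (\<rho> * (a + 1))) \<le> min_abs_nz xbar \<longrightarrow>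
               regular_critical_point (zero_norm_objective f A b \<Omega> \<mu> (lam / \<rho>)) xbar)
          \<and> Q_linearly_converges x xbar)"
proof -
  have x0: "x 0 \<in> \<Omega>"
    and step: "\<And>k. is_arg_min (MM_model f A b \<mu> a lam \<rho> (\<gamma>\<^sub>1 k) (\<gamma>\<^sub>2 k) (x k)) (\<lambda>z. z \<in> \<Omega>) (x (Suc k))"
    and rec1: "\<And>k. \<gamma>\<^sub>1 (Suc k) = max \<gamma>1_low (varrho * \<gamma>\<^sub>1 k)"
    and rec2: "\<And>k. \<gamma>\<^sub>2 (Suc k) = max \<gamma>2_low (varrho * \<gamma>\<^sub>1 k)"
    using assms(16) unfolding proximal_MM_sequence_def by blast+
  obtain N where N: "\<And>k. k \<ge> N \<Longrightarrow> \<gamma>\<^sub>1 k = \<gamma>\<^sub>1 N"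
    using proximal_parameter_eventually_constant[of \<gamma>\<^sub>1 \<gamma>1_low varrho] rec1 assms(12,14,15) by blast
  \<comment> \<open>\<open>\<gamma>\<^sub>2\<close> follows \<open>\<gamma>\<^sub>1\<close> with a delay of one step.\<close>
  define M where "M = Suc N"
  define g1 g2 where "g1 = \<gamma>\<^sub>1 M" and "g2 = \<gamma>\<^sub>2 M"
  have \<gamma>1: "\<gamma>\<^sub>1 (M + k) = g1" for k using N[of "M + k"] N[of M] by (simp add: M_def g1_def)
  have \<gamma>2: "\<gamma>\<^sub>2 (M + k) = g2" for k
    using N[of "N + k"] by (simp add: M_def g2_def rec2)
  have x_in: "x k \<in> \<Omega>" for k
    using x0 step by (cases k) (auto simp: is_arg_min_def)
  interpret proximal_MM f A b \<Omega> \<mu> a lam \<rho> g1 g2 "\<lambda>k. x (M + k)"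
  proof
    show "MM_model f A b \<mu> a lam \<rho> g1 g2 (x (M + k)) (x (M + Suc k))
        \<le> MM_model f A b \<mu> a lam \<rho> g1 g2 (x (M + k)) y" if "y \<in> \<Omega>" for k y
      using step[of "M + k"] that unfolding \<gamma>1 \<gamma>2 is_arg_min_def by fastforce
    show "g1 > 0" "g2 > 0" using assms(12,13) by (auto simp: g1_def g2_def M_def rec1 rec2)
  qed (use assms x_in in auto)
  obtain K q where q: "0 < q" "q < 1"
    and geo: "\<And>k. norm (x (M + Suc k) - x (M + k)) \<le> K * q ^ k"
    using steps_geometric by blast
  obtain p where lim: "(\<lambda>k. x (M + k)) \<longlonglongrightarrow> p"
    and R: "\<And>k. norm (x (M + k) - p) \<le> K / (1 - q) * q ^ k"
    using geometric_steps_limit[OF q, of "\<lambda>k. x (M + k)" K] geo by blast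
  interpret proximal_MM_limit f A b \<Omega> \<mu> a lam \<rho> g1 g2 "\<lambda>k. x (M + k)" p "K / (1 - q)" q
    by unfold_locales (use q lim R in auto)
  have "summable (\<lambda>k. norm (x (M + Suc k) - x (M + k)))"
  proof (rule summable_comparison_test')
    show "summable (\<lambda>k. K * q ^ k)" using q by (intro summable_mult summable_geometric) auto
    show "norm (norm (x (M + Suc k) - x (M + k))) \<le> K * q ^ k" for k using geo by simp
  qed
  then have "summable (\<lambda>k. norm (x (Suc k) - x k))"
    using summable_iff_shift[of "\<lambda>k. norm (x (Suc k) - x k)" M] by (simp add: add.commute)
  then have "summable (\<lambda>k. norm (x (Suc (Suc k)) - x (Suc k)))"
    using summable_Suc_iff[of "\<lambda>k. norm (x (Suc k) - x k)"] by simp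
  moreover have "x \<longlonglongrightarrow> p"
    using lim by (intro LIMSEQ_offset[of x M]) (simp add: add.commute)
  moreover have "critical_point (Theta f A b \<Omega> \<mu> a lam \<rho>) p"
    using regular_critical_point_Theta regular_subdifferential_subset_limiting
    unfolding critical_point_def regular_critical_point_def by blast
  moreover have "Q_linearly_converges x p"
  proof -
    obtain c where c: "0 < c" "c < 1"
      and ev: "\<forall>\<^sub>F k in sequentially. norm (x (Suc (k + M)) - p) \<le> c * norm (x (k + M) - p)"
      using Q_linearly_converges unfolding Q_linearly_converges_def by (auto simp: add.commute)
    from ev have "\<forall>\<^sub>F k in sequentially. norm (x (Suc k) - p) \<le> c * norm (x k - p)"
      by (rule eventually_sequentially_seg[THEN iffD1])
    with c \<open>x \<longlonglongrightarrow> p\<close> show ?thesis unfolding Q_linearly_converges_def by blast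
  qed
  ultimately show ?thesis using regular_critical_point_zero_norm by blast
qed

end
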